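(* Let $\Gamma$ and $\Lambda$ be finitely generated non-amenable discrete groups, and suppose that $\Gamma$ and $\Lambda$ are $L^q$-measure equivalent for some $q\ge 1$. (1) For every real $p$ with $1<p\le q$: $l^pH^1(\Gamma)\neq 0$ if and only if $l^pH^1(\Lambda)\neq 0$. (2) (Case $p=1$.) If $l^1H^1(\Lambda)=0$, then every affine action associated to $l^1H^1(\Gamma)$ has bounded orbits; that is, for every 1-cocycle $b:\Gamma\to l^1(\Gamma)$ with respect to the right-regular representation $\rho_\Gamma$ of $\Gamma$ on $l^1(\Gamma)$, the affine isometric action $\gamma\mapsto \big(v\mapsto \rho_\Gamma(\gamma)v+b(\gamma)\big)$ of $\Gamma$ on $l^1(\Gamma)$ has bounded orbits.
   Context: Measure equivalence. Two countable discrete groups $\Gamma,\Lambda$ are measure equivalent (ME) if there is a nonzero $\sigma$-finite measure space $(X,\mu)$ with commuting, free, $\mu$-preserving actions of $\Gamma$ and $\Lambda$, each having a finite-measure fundamental domain $X_\Gamma$, resp. $X_\Lambda$: $X=\bigsqcup_{\gamma\in\Gamma}\gamma X_\Gamma=\bigsqcup_{\lambda\in\Lambda}\lambda X_\Lambda$. The associated cocycles $\alpha:\Gamma\times X_\Lambda\to\Lambda$ and $\beta:\Lambda\times X_\Gamma\to\Gamma$ are defined by $\alpha(\gamma,x)\gamma x\in X_\Lambda$ for $x\in X_\Lambda$ and $\beta(\lambda,y)\lambda y\in X_\Gamma$ for $y\in X_\Gamma$. For finitely generated $\Gamma,\Lambda$ with word lengths $|\cdot|$ (for fixed finite generating sets),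 they are $L^q$-measure equivalent ($L^q$-ME) if such a coupling can be chosen with $\int_{X_\Lambda}|\alpha(\gamma,x)|^q\,d\mu(x)<\infty$ for all $\gamma\in\Gamma$ and $\int_{X_\Gamma}|\beta(\lambda,y)|^q\,d\mu(y)<\infty$ for all $\lambda\in\Lambda$. First $l^p$-cohomology. For $p\in[1,\infty)$ and a finitely generated group $\Gamma$, fix a Cayley graph (with respect to a finite generating set) with vertex set $V_\Gamma$ and edge set $E_\Gamma$. For $f:V_\Gamma\to\mathbb R$ let $df:E_\Gamma\to\mathbb R$, $df(ab)=f(b)-f(a)$. Then $l^pH^1(\Gamma)$ is the quotient of $\{f:V_\Gamma\to\mathbb R: df\in l^p(E_\Gamma)\}$ by the subspace spanned by $l^p(V_\Gamma)$ and the constant functions. Its vanishing does not depend on the chosen Cayley graph. 1-cocycles. For an isometric representation $\pi$ of $\Gamma$ on a Banach space $\mathcal B$, a 1-cocycle is a map $b:\Gamma\to\mathcal B$ with $b(gh)=b(g)+\pi(g)b(h)$ for all $g,h\in\Gamma$. The right-regular representation is $(\rho_\Gamma(\gamma)f)(\delta)=f(\delta\gamma)$. *)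

theory Defs
  imports
    "HOL-Analysis.Analysis"
    "HOL-Library.Function_Algebras"
    "HOL-Algebra.Group_Action"
    "HOL-Algebra.Generated_Groups"
begin

section \<open>Finitely generated and amenable groups\<close>

definition finite_generating_set :: "('a, 'c) monoid_scheme \<Rightarrow> 'a set \<Rightarrow> bool" where
  "finite_generating_set G S \<longleftrightarrow> finite S \<and> S \<subseteq> carrier G \<and> generate G S = carrier G"

definition word_length :: "('a, 'c) monoid_scheme \<Rightarrow> 'a set \<Rightarrow> 'a \<Rightarrow> nat" where
  "word_length G S g =
    (LEAST n. \<exists>ws. length ws = n \<and> set ws \<subseteq> S \<union> m_inv G ` S \<and>
                   foldr (\<lambda>x y. x \<otimes>\<^bsub>G\<^esub> y) ws \<one>\<^bsub>G\<^esub> = g)"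

text \<open>Amenability of a discrete group, in von Neumann's form: there is a left-invariant finitely
  additive probability measure on all subsets of the group.\<close>

definition amenable :: "('a, 'c) monoid_scheme \<Rightarrow> bool" where
  "amenable G \<longleftrightarrow> (\<exists>m :: 'a set \<Rightarrow> real.
     (\<forall>A \<subseteq> carrier G. 0 \<le> m A) \<and>
     m (carrier G) = 1 \<and>
     (\<forall>A \<subseteq> carrier G. \<forall>B \<subseteq> carrier G. A \<inter> B = {} \<longrightarrow> m (A \<union> B) = m A + m B) \<and>
     (\<forall>g \<in> carrier G. \<forall>A \<subseteq> carrier G. m (g <#\<^bsub>G\<^esub> A) = m A))"


section \<open>Measure equivalence\<close>

definition free_mp_action ::
    "('a, 'c) monoid_scheme \<Rightarrow> 'x measure \<Rightarrow> ('a \<Rightarrow> 'x \<Rightarrow> 'x) \<Rightarrow> bool" where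
  "free_mp_action G M \<phi> \<longleftrightarrow>
     group_action G (space M) \<phi> \<and>
     (\<forall>g \<in> carrier G. \<phi> g \<in> measurable M M \<and> distr M M (\<phi> g) = M) \<and>
     (\<forall>g \<in> carrier G. \<forall>x \<in> space M. \<phi> g x = x \<longrightarrow> g = \<one>\<^bsub>G\<^esub>)"

definition finite_fundamental_domain ::
    "('a, 'c) monoid_scheme \<Rightarrow> 'x measure \<Rightarrow> ('a \<Rightarrow> 'x \<Rightarrow> 'x) \<Rightarrow> 'x set \<Rightarrow> bool" where
  "finite_fundamental_domain G M \<phi> D \<longleftrightarrow>
     D \<in> sets M \<and> emeasure M D < \<infinity> \<and>
     disjoint_family_on (\<lambda>g. \<phi> g ` D) (carrier G) \<and>
     (\<Union>g \<in> carrier G. \<phi> g ` D) = space M"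

definition ME_coupling ::
    "('a, 'c) monoid_scheme \<Rightarrow> ('b, 'd) monoid_scheme \<Rightarrow> 'x measure \<Rightarrow>
     ('a \<Rightarrow> 'x \<Rightarrow> 'x) \<Rightarrow> ('b \<Rightarrow> 'x \<Rightarrow> 'x) \<Rightarrow> 'x set \<Rightarrow> 'x set \<Rightarrow> bool" where
  "ME_coupling G H M \<phi> \<psi> XG XH \<longleftrightarrow>
     sigma_finite_measure M \<and> emeasure M (space M) \<noteq> 0 \<and>
     free_mp_action G M \<phi> \<and> free_mp_action H M \<psi> \<and>
     (\<forall>g \<in> carrier G. \<forall>h \<in> carrier H. \<forall>x \<in> space M. \<phi> g (\<psi> h x) = \<psi> h (\<phi> g x)) \<and>
     finite_fundamental_domain G M \<phi> XG \<and> finite_fundamental_domain H M \<psi> XH"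

text \<open>With \<open>D\<close> a fundamental domain of the action \<open>\<psi>\<close> of \<open>H\<close>, this is the cocycle
  \<open>\<alpha>(g,x)\<close> determined by \<open>\<alpha>(g,x) g x \<in> D\<close> for \<open>x \<in> D\<close>.
  The cocycle \<open>\<beta>\<close> is obtained by exchanging the roles of the two actions.\<close>

definition ME_cocycle ::
    "('b, 'd) monoid_scheme \<Rightarrow> ('a \<Rightarrow> 'x \<Rightarrow> 'x) \<Rightarrow> ('b \<Rightarrow> 'x \<Rightarrow> 'x) \<Rightarrow> 'x set \<Rightarrow> 'a \<Rightarrow> 'x \<Rightarrow> 'b" where
  "ME_cocycle H \<phi> \<psi> D g x = (THE h. h \<in> carrier H \<and> \<psi> h (\<phi> g x) \<in> D)"

text \<open>The argument of type \<open>'x itself\<close> names the type carrying the coupling space, as HOL has no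
  quantification over types inside a formula. In a hypothesis with \<open>'x\<close> a type variable not
  occurring elsewhere, this amounts to the existence of a coupling on some space.
  The generating sets \<open>S\<close> and \<open>T\<close> only serve to define word lengths, and the integrability
  condition does not depend on them.\<close>

definition Lq_measure_equivalent ::
    "'x itself \<Rightarrow> real \<Rightarrow> ('a, 'c) monoid_scheme \<Rightarrow> ('b, 'd) monoid_scheme \<Rightarrow> bool" where
  "Lq_measure_equivalent X q G H \<longleftrightarrow>
     (\<exists>S T (M :: 'x measure) \<phi> \<psi> XG XH.
        finite_generating_set G S \<and> finite_generating_set H T \<and>
        ME_coupling G H M \<phi> \<psi> XG XH \<and>
        (\<forall>g \<in> carrier G.
           (\<integral>\<^sup>+x\<in>XH. ennreal (real (word_length H T (ME_cocycle H \<phi> \<psi> XH g x)) powr q) \<partial>M) < \<infinity>) \<and>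
        (\<forall>h \<in> carrier H.
           (\<integral>\<^sup>+x\<in>XG. ennreal (real (word_length G S (ME_cocycle G \<psi> \<phi> XG h x)) powr q) \<partial>M) < \<infinity>))"


section \<open>First \<open>l\<^sup>p\<close>-cohomology\<close>

text \<open>A real function on a set \<open>V\<close> is represented by its extension by zero to the whole type, so
  that pointwise equality, addition and scaling are those of functions on \<open>V\<close>.\<close>

definition funs_on :: "'v set \<Rightarrow> ('v \<Rightarrow> real) set" where
  "funs_on V = {f. \<forall>x. x \<notin> V \<longrightarrow> f x = 0}"

definition on_set :: "'v set \<Rightarrow> ('v \<Rightarrow> real) \<Rightarrow> 'v \<Rightarrow> real" where
  "on_set V f = (\<lambda>x. if x \<in> V then f x else 0)"

definition lp_space :: "real \<Rightarrow> 'v set \<Rightarrow> ('v \<Rightarrow> real) set" where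
  "lp_space p V = {f \<in> funs_on V. (\<lambda>x. \<bar>f x\<bar> powr p) summable_on V}"

definition lp_norm :: "real \<Rightarrow> 'v set \<Rightarrow> ('v \<Rightarrow> real) \<Rightarrow> real" where
  "lp_norm p V f = (\<Sum>\<^sub>\<infinity>x\<in>V. \<bar>f x\<bar> powr p) powr (1 / p)"

text \<open>The edges join \<open>g\<close> to \<open>gs\<close>, the Cayley graph matching the right-regular representation;
  each edge is oriented by a generator. Inversion exchanges this graph with the one whose edges
  join \<open>g\<close> to \<open>sg\<close>.\<close>

definition cayley_edges :: "('a, 'c) monoid_scheme \<Rightarrow> 'a set \<Rightarrow> ('a \<times> 'a) set" where
  "cayley_edges G S = {(g, g \<otimes>\<^bsub>G\<^esub> s) | g s. g \<in> carrier G \<and> s \<in> S}"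

definition edge_diff :: "('a \<times> 'a) set \<Rightarrow> ('a \<Rightarrow> real) \<Rightarrow> 'a \<times> 'a \<Rightarrow> real" where
  "edge_diff E f = on_set E (\<lambda>(a, b). f b - f a)"

definition lp_dirichlet :: "real \<Rightarrow> ('a, 'c) monoid_scheme \<Rightarrow> 'a set \<Rightarrow> ('a \<Rightarrow> real) set" where
  "lp_dirichlet p G S =
     {f \<in> funs_on (carrier G). edge_diff (cayley_edges G S) f \<in> lp_space p (cayley_edges G S)}"

definition lp_trivial :: "real \<Rightarrow> ('a, 'c) monoid_scheme \<Rightarrow> ('a \<Rightarrow> real) set" where
  "lp_trivial p G =
     module.span (\<lambda>(c :: real) f x. c * f x)
       (lp_space p (carrier G) \<union> range (\<lambda>c. on_set (carrier G) (\<lambda>_. c)))"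

definition lpH1 :: "real \<Rightarrow> ('a, 'c) monoid_scheme \<Rightarrow> 'a set \<Rightarrow> ('a \<Rightarrow> real) set set" where
  "lpH1 p G S =
     lp_dirichlet p G S //
       {(f, f'). f \<in> lp_dirichlet p G S \<and> f' \<in> lp_dirichlet p G S \<and> f - f' \<in> lp_trivial p G}"

text \<open>The zero of the quotient space is the class \<open>lp_trivial p G\<close>.\<close>

definition lpH1_is_zero :: "real \<Rightarrow> ('a, 'c) monoid_scheme \<Rightarrow> 'a set \<Rightarrow> bool" where
  "lpH1_is_zero p G S \<longleftrightarrow> lpH1 p G S = {lp_trivial p G}"


section \<open>Cocycles and affine actions\<close>

definition right_regular ::
    "('a, 'c) monoid_scheme \<Rightarrow> 'a \<Rightarrow> ('a \<Rightarrow> real) \<Rightarrow> 'a \<Rightarrow> real" where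
  "right_regular G g f = on_set (carrier G) (\<lambda>x. f (x \<otimes>\<^bsub>G\<^esub> g))"

definition one_cocycle ::
    "('a, 'c) monoid_scheme \<Rightarrow> 'v::ab_group_add set \<Rightarrow> ('a \<Rightarrow> 'v \<Rightarrow> 'v) \<Rightarrow> ('a \<Rightarrow> 'v) \<Rightarrow> bool" where
  "one_cocycle G B \<pi> b \<longleftrightarrow>
     b \<in> carrier G \<rightarrow> B \<and>
     (\<forall>g \<in> carrier G. \<forall>h \<in> carrier G. b (g \<otimes>\<^bsub>G\<^esub> h) = b g + \<pi> g (b h))"

definition affine_action ::
    "('a \<Rightarrow> 'v \<Rightarrow> 'v) \<Rightarrow> ('a \<Rightarrow> 'v) \<Rightarrow> 'a \<Rightarrow> 'v::ab_group_add \<Rightarrow> 'v" where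
  "affine_action \<pi> b g v = \<pi> g v + b g"

definition bounded_orbits ::
    "('a, 'c) monoid_scheme \<Rightarrow> 'v set \<Rightarrow> ('v \<Rightarrow> real) \<Rightarrow> ('a \<Rightarrow> 'v \<Rightarrow> 'v) \<Rightarrow> bool" where
  "bounded_orbits G B nrm \<phi> \<longleftrightarrow> (\<forall>v \<in> B. \<exists>C. \<forall>u \<in> orbit G \<phi> v. nrm u \<le> C)"

end

theory Submission
  imports Defs
begin

text \<open>
  A function \<open>f\<close> on \<open>G\<close> with \<open>df \<in> l\<^sup>p\<close> induces \<open>F(g y) = f(g)\<close>, \<open>y \<in> X\<^sub>G\<close>, on the coupling space \<open>X\<close>.
  The integrability of the cocycle gives \<open>F(h \<cdot>) - F \<in> L\<^sup>p(X)\<close> for \<open>h \<in> H\<close>, because the \<open>l\<^sup>p\<close>-norm of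
  \<open>f(\<cdot> g) - f\<close> grows at most linearly in the word length of \<open>g\<close>. On almost every \<open>H\<close>-orbit the vanishing of
  \<open>l\<^sup>pH\<^sup>1(H)\<close> makes \<open>F\<close> differ from a constant \<open>c\<close> by an \<open>l\<^sup>p\<close> function, and the spectral gap that
  non-amenability provides bounds its norm, so that \<open>F - c \<in> L\<^sup>p(X)\<close> with \<open>c\<close> invariant under \<open>H\<close>.
  Then \<open>x \<mapsto> c(\<cdot> x)\<close> is a \<open>G\<close>-equivariant map from the finite measure space \<open>X / H\<close> to the affine space
  \<open>f + l\<^sup>p(G)\<close>, and the invariant finite measure forces \<open>f(\<cdot> g) - f\<close> to be bounded in \<open>l\<^sup>p\<close>. This is the
  claim for \<open>p = 1\<close>, and in general a circumcenter argument then shows that \<open>f\<close> is a constant plus an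
  \<open>l\<^sup>p\<close> function.
\<close>

section \<open>Inequalities for powers\<close>

text \<open>On a single orbit the vanishing of the cohomology only provides some constant, whereas c
  has to be measurable and H-invariant. A non-amenable group is infinite, so the constant is forced
  to be the limit of F along an injective enumeration of H, and such a limit is measurable. Nor does
  vanishing bound the remaining l^p function; the gap inequality does so by finitely many
  displacements, with one constant for all orbits, and these displacements are integrable. The gap
  is proved for every p > 0 at once, by normalizing |v|^p to probability measures on the group. The
  circumcenter argument needs uniform convexity, which has its simplest form at even exponents. The
  exponent is therefore raised to some 2m >= p, which bounded oscillation permits, and brought back
  to p by Fatou's lemma, as the constant is a pointwise limit of right translates of f. Averaging
  over X / H is replaced by a pigeonhole argument on sublevel sets, so that no vector-valued
  integral appears.\<close>

lemma add_powr_le: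
  fixes a b p :: real
  assumes "0 \<le> a" "0 \<le> b" "0 \<le> p"
  shows "(a + b) powr p \<le> 2 powr p * (a powr p + b powr p)"
proof -
  have "(a + b) powr p \<le> (2 * max a b) powr p"
    using assms by (intro powr_mono2) auto
  also have "\<dots> = 2 powr p * max a b powr p"
    using assms by (simp add: powr_mult)
  also have "\<dots> \<le> 2 powr p * (a powr p + b powr p)"
    by (intro mult_left_mono) (auto simp: max_def)
  finally show ?thesis .
qed

text \<open>Convexity of the power function at the points a (t + 1) / t and b (t + 1), with weights
  t / (t + 1) and 1 / (t + 1). The factor in \<open>add_powr_le\<close> would multiply up at every
  letter of a word; adapting t to the length avoids this.\<close>

lemma weighted_add_powr_le:
  fixes a b p t :: real
  assumes "0 \<le> a" "0 \<le> b" "1 \<le> p" "0 < t"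
  shows "(a + b) powr p \<le> (t + 1) powr (p - 1) * (t powr (1 - p) * a powr p + b powr p)"
proof (cases "a = 0 \<or> b = 0")
  case True
  \<comment> \<open>If a or b is zero, it is enough that both coefficients on the right are at least
    1.\<close>
  have "1 powr (p - 1) \<le> (t + 1) powr (p - 1)" "t powr (p - 1) \<le> (t + 1) powr (p - 1)"
    using assms by (intro powr_mono2; simp)+
  moreover from this(2) have "t powr (p - 1) * t powr (1 - p) \<le> (t + 1) powr (p - 1) * t powr (1 - p)"
    by (rule mult_right_mono) simp
  ultimately have "1 \<le> (t + 1) powr (p - 1)" "1 \<le> (t + 1) powr (p - 1) * t powr (1 - p)"
    using assms by (simp_all flip: powr_add)
  from True this[THEN mult_right_mono, of "a powr p"] this[THEN mult_right_mono, of "b powr p"]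
  show ?thesis using assms by (auto simp: mult.assoc)
next
  case False
  then have pos: "0 < a" "0 < b" using assms by auto
  have "(a + b) powr p = ((1 - 1 / (t + 1)) *\<^sub>R (a * (t + 1) / t) + (1 / (t + 1)) *\<^sub>R (b * (t + 1))) powr p"
    using assms by (simp add: divide_simps)
  also have "\<dots> \<le> (1 - 1 / (t + 1)) * (a * (t + 1) / t) powr p + (1 / (t + 1)) * (b * (t + 1)) powr p"
    using assms pos by (intro convex_onD[OF powr_convex]) auto
  also have "(1 - 1 / (t + 1)) * (a * (t + 1) / t) powr p = (t + 1) powr (p - 1) * (t powr (1 - p) * a powr p)"
    using assms pos by (simp add: powr_mult powr_divide powr_diff divide_simps)
  also have "(1 / (t + 1)) * (b * (t + 1)) powr p = (t + 1) powr (p - 1) * b powr p"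
    using assms pos by (simp add: powr_mult powr_divide powr_diff divide_simps)
  finally show ?thesis by (simp add: algebra_simps)
qed

text \<open>The coefficient of b may be as close to 1 as desired, at the price of a large constant
  on the error d. If d <= \<delta> b, the error is absorbed into b; otherwise b <= d / \<delta> and
  everything is charged to d.\<close>

lemma powr_le_perturb:
  fixes p \<epsilon> :: real
  assumes "0 < p" "0 < \<epsilon>"
  obtains C where "0 \<le> C"
    "\<And>a b d. \<lbrakk>0 \<le> a; 0 \<le> b; 0 \<le> d; a \<le> b + d\<rbrakk> \<Longrightarrow> a powr p \<le> (1 + \<epsilon>) * b powr p + C * d powr p"
proof -
  define \<delta> where "\<delta> = (1 + \<epsilon>) powr (1 / p) - 1"
  have \<delta>: "0 < \<delta>" "(1 + \<delta>) powr p = 1 + \<epsilon>"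
    using assms by (auto simp: \<delta>_def powr_powr intro: gr_one_powr)
  have "a powr p \<le> (1 + \<epsilon>) * b powr p + (1 + 1 / \<delta>) powr p * d powr p"
    if "0 \<le> a" "0 \<le> b" "0 \<le> d" "a \<le> b + d" for a b d
  proof (cases "d \<le> \<delta> * b")
    case True
    then have "a powr p \<le> ((1 + \<delta>) * b) powr p"
      using that assms by (intro powr_mono2) (auto simp: algebra_simps)
    also have "\<dots> = (1 + \<epsilon>) * b powr p"
      using that \<delta> by (subst powr_mult) auto
    also have "\<dots> \<le> (1 + \<epsilon>) * b powr p + (1 + 1 / \<delta>) powr p * d powr p"
      by simp
    finally show ?thesis .
  next
    case False
    then have "b \<le> d / \<delta>"
      using \<delta> by (simp add: field_simps)
    then have "a powr p \<le> ((1 + 1 / \<delta>) * d) powr p"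
      using that assms by (intro powr_mono2) (auto simp: algebra_simps)
    also have "\<dots> = (1 + 1 / \<delta>) powr p * d powr p"
      using that \<delta> by (subst powr_mult) auto
    also have "\<dots> \<le> (1 + \<epsilon>) * b powr p + (1 + 1 / \<delta>) powr p * d powr p"
      using assms by simp
    finally show ?thesis .
  qed
  then show thesis
    by (intro that[of "(1 + 1 / \<delta>) powr p"]) auto
qed

text \<open>Clarkson's inequality at an even exponent. Seen as m-th powers of squares, the terms are
  compared by superadditivity and midpoint convexity of the m-th power on nonnegative numbers,
  joined by the parallelogram identity.\<close>

lemma even_power_midpoint:
  fixes a b :: real
  assumes "0 < m"
  shows "((a + b) / 2) ^ (2 * m) + ((a - b) / 2) ^ (2 * m) \<le> (a ^ (2 * m) + b ^ (2 * m)) / 2"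
proof -
  have superadd: "x ^ m + y ^ m \<le> (x + y) ^ m" if "0 \<le> x" "0 \<le> y" for x y :: real
    using \<open>0 < m\<close>
  proof (induction m rule: nat_induct_non_zero)
    case (Suc n)
    have "x ^ Suc n + y ^ Suc n \<le> (x + y) * (x ^ n + y ^ n)"
      using that by (simp add: algebra_simps)
    also have "\<dots> \<le> (x + y) * (x + y) ^ n"
      using that Suc by (intro mult_left_mono) auto
    finally show ?case by simp
  qed simp
  have conv: "((u + v) / 2) ^ m \<le> (u ^ m + v ^ m) / 2" if "0 \<le> u" "0 \<le> v" for u v :: real
  proof (cases "u = 0 \<or> v = 0 \<or> m = 1")
    case True
    have "1 \<le> (2::real) ^ (m - 1)" by simp
    then have "2 \<le> (2::real) ^ m" using \<open>0 < m\<close>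
      by (cases m) auto
    then have "inverse (2 ^ m) \<le> inverse (2 :: real)"
      by (intro le_imp_inverse_le) auto
    then have "x * inverse (2 ^ m) \<le> x * inverse 2" if "0 \<le> x" for x :: real
      using that by (rule mult_left_mono)
    from this[of "u ^ m"] this[of "v ^ m"] show ?thesis
      using True that \<open>0 < m\<close> by (auto simp: power_divide field_simps zero_power)
  next
    case False
    then have "0 < u" "0 < v" using that by auto
    then have "((1 - 1 / 2) *\<^sub>R u + (1 / 2) *\<^sub>R v) powr m \<le> (1 - 1 / 2) * u powr m + (1 / 2) * v powr m"
      using \<open>0 < m\<close> by (intro convex_onD[OF powr_convex]) auto
    then show ?thesis
      using \<open>0 < u\<close> \<open>0 < v\<close> by (simp add: powr_realpow add_divide_distrib)
  qed
  have "((a + b) / 2) ^ (2 * m) + ((a - b) / 2) ^ (2 * m)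
      = (((a + b) / 2)\<^sup>2) ^ m + (((a - b) / 2)\<^sup>2) ^ m"
    by (simp add: power_mult)
  also have "\<dots> \<le> (((a + b) / 2)\<^sup>2 + ((a - b) / 2)\<^sup>2) ^ m"
    by (rule superadd) auto
  also have "((a + b) / 2)\<^sup>2 + ((a - b) / 2)\<^sup>2 = (a\<^sup>2 + b\<^sup>2) / 2"
    by (simp add: power2_eq_square field_simps)
  also have "\<dots> ^ m \<le> ((a\<^sup>2) ^ m + (b\<^sup>2) ^ m) / 2"
    by (rule conv) auto
  finally show ?thesis
    by (simp add: power_mult)
qed

section \<open>Sums of \<open>p\<close>-th powers\<close>

text \<open>The p-th power of the norm, with infinity allowed: sums need no summability conditions,
  p < 1 is harmless, and the energy can be integrated over the coupling space with Tonelli's and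
  Fatou's theorems.\<close>

definition lp_energy :: "real \<Rightarrow> 'v set \<Rightarrow> ('v \<Rightarrow> real) \<Rightarrow> ennreal" where
  "lp_energy p A f = (\<integral>\<^sup>+x. ennreal (\<bar>f x\<bar> powr p) \<partial>count_space A)"

lemma lp_energy_cong:
  "(\<And>x. x \<in> A \<Longrightarrow> \<bar>f x\<bar> = \<bar>g x\<bar>) \<Longrightarrow> lp_energy p A f = lp_energy p A g"
  unfolding lp_energy_def by (rule nn_integral_cong) simp

lemma lp_energy_minus_commute: "lp_energy p A (\<lambda>x. f x - g x) = lp_energy p A (\<lambda>x. g x - f x)"
  by (rule lp_energy_cong) (rule abs_minus_commute)

lemma lp_energy_bij_betw:
  "bij_betw j A B \<Longrightarrow> lp_energy p A (\<lambda>x. f (j x)) = lp_energy p B f"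
  unfolding lp_energy_def by (rule nn_integral_bij_count_space)

lemma lp_energy_mono_set:
  assumes "A \<subseteq> B"
  shows "lp_energy p A f \<le> lp_energy p B f"
proof -
  have "lp_energy p A f = (\<integral>\<^sup>+x. ennreal (\<bar>f x\<bar> powr p) * indicator A x \<partial>count_space B)"
    unfolding lp_energy_def using assms
    by (simp add: nn_integral_restrict_space[symmetric] restrict_count_space Int_absorb2 Int_absorb1)
  also have "\<dots> \<le> lp_energy p B f"
    unfolding lp_energy_def by (rule nn_integral_mono) (simp add: indicator_def)
  finally show ?thesis .
qed

lemma lp_energy_singleton: "lp_energy p {a} f = ennreal (\<bar>f a\<bar> powr p)"
  by (simp add: lp_energy_def nn_integral_count_space_finite)

lemma le_lp_energy: "a \<in> A \<Longrightarrow> ennreal (\<bar>f a\<bar> powr p) \<le> lp_energy p A f"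
  using lp_energy_mono_set[of "{a}" A p f] by (simp add: lp_energy_singleton)

lemma lp_energy_add:
  assumes "0 \<le> p"
  shows "lp_energy p A (\<lambda>x. f x + g x) \<le> ennreal (2 powr p) * (lp_energy p A f + lp_energy p A g)"
proof -
  have *: "\<bar>f x + g x\<bar> powr p \<le> 2 powr p * (\<bar>f x\<bar> powr p + \<bar>g x\<bar> powr p)" for x
  proof -
    have "\<bar>f x + g x\<bar> powr p \<le> (\<bar>f x\<bar> + \<bar>g x\<bar>) powr p"
      using assms by (intro powr_mono2) auto
    also have "\<dots> \<le> 2 powr p * (\<bar>f x\<bar> powr p + \<bar>g x\<bar> powr p)"
      using assms by (intro add_powr_le) auto
    finally show ?thesis .
  qed
  have "lp_energy p A (\<lambda>x. f x + g x)
      \<le> (\<integral>\<^sup>+x. ennreal (2 powr p) * (ennreal (\<bar>f x\<bar> powr p) + ennreal (\<bar>g x\<bar> powr p)) \<partial>count_space A)"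
    unfolding lp_energy_def
    by (intro nn_integral_mono) (rule order_trans[OF ennreal_leI], rule *, simp add: ennreal_mult)
  also have "\<dots> = ennreal (2 powr p) * (lp_energy p A f + lp_energy p A g)"
    by (simp add: lp_energy_def nn_integral_cmult nn_integral_add)
  finally show ?thesis .
qed

lemma lp_energy_triangle:
  assumes "0 \<le> p"
  shows "lp_energy p A (\<lambda>x. f x - g x)
    \<le> ennreal (2 powr p) * (lp_energy p A (\<lambda>x. f x - h x) + lp_energy p A (\<lambda>x. h x - g x))"
  using lp_energy_add[OF assms, of A "\<lambda>x. f x - h x" "\<lambda>x. h x - g x"] by simp

lemma lp_energy_triangle_finite:
  assumes "0 \<le> p" "lp_energy p A (\<lambda>x. f x - h x) < \<infinity>" "lp_energy p A (\<lambda>x. h x - g x) < \<infinity>"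
  shows "lp_energy p A (\<lambda>x. f x - g x) < \<infinity>"
proof -
  note lp_energy_triangle[OF assms(1), of A f g h]
  also have "ennreal (2 powr p) * (lp_energy p A (\<lambda>x. f x - h x) + lp_energy p A (\<lambda>x. h x - g x)) < \<infinity>"
    using assms(2,3) by (simp add: ennreal_mult_less_top)
  finally show ?thesis .
qed

lemma lp_energy_weighted_add:
  assumes "1 \<le> p" "0 < t"
  shows "lp_energy p A (\<lambda>x. f x + g x)
    \<le> ennreal ((t + 1) powr (p - 1)) * (ennreal (t powr (1 - p)) * lp_energy p A f + lp_energy p A g)"
proof -
  have *: "\<bar>f x + g x\<bar> powr p
      \<le> (t + 1) powr (p - 1) * (t powr (1 - p) * \<bar>f x\<bar> powr p + \<bar>g x\<bar> powr p)" for x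
  proof -
    have "\<bar>f x + g x\<bar> powr p \<le> (\<bar>f x\<bar> + \<bar>g x\<bar>) powr p"
      using assms by (intro powr_mono2) auto
    also have "\<dots> \<le> (t + 1) powr (p - 1) * (t powr (1 - p) * \<bar>f x\<bar> powr p + \<bar>g x\<bar> powr p)"
      using assms by (intro weighted_add_powr_le) auto
    finally show ?thesis .
  qed
  have "lp_energy p A (\<lambda>x. f x + g x)
      \<le> (\<integral>\<^sup>+x. ennreal ((t + 1) powr (p - 1)) * (ennreal (t powr (1 - p)) * ennreal (\<bar>f x\<bar> powr p)
            + ennreal (\<bar>g x\<bar> powr p)) \<partial>count_space A)"
    unfolding lp_energy_def
    by (intro nn_integral_mono) (rule order_trans[OF ennreal_leI], rule *, simp add: ennreal_mult)
  also have "\<dots> = ennreal ((t + 1) powr (p - 1)) * (ennreal (t powr (1 - p)) * lp_energy p A f + lp_energy p A g)"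
    by (simp add: lp_energy_def nn_integral_cmult nn_integral_add)
  finally show ?thesis .
qed

lemma lp_energy_finite_summable:
  "lp_energy p A f < \<infinity> \<longleftrightarrow> (\<lambda>x. \<bar>f x\<bar> powr p) summable_on A"
proof -
  have "(\<lambda>x. \<bar>f x\<bar> powr p) summable_on A \<longleftrightarrow> (\<lambda>x. norm (\<bar>f x\<bar> powr p)) summable_on A"
    by simp
  also have "\<dots> \<longleftrightarrow> Infinite_Set_Sum.abs_summable_on (\<lambda>x. \<bar>f x\<bar> powr p) A"
    by (rule abs_summable_equivalent)
  also have "\<dots> \<longleftrightarrow> lp_energy p A f < \<infinity>"
    by (simp add: Infinite_Set_Sum.abs_summable_on_def integrable_iff_bounded lp_energy_def)
  finally show ?thesis by simp
qed

lemma lp_energy_eq_infsum: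
  assumes "lp_energy p A f < \<infinity>"
  shows "lp_energy p A f = ennreal (\<Sum>\<^sub>\<infinity>x\<in>A. \<bar>f x\<bar> powr p)"
proof -
  have "Infinite_Set_Sum.abs_summable_on (\<lambda>x. \<bar>f x\<bar> powr p) A"
    using assms by (simp add: Infinite_Set_Sum.abs_summable_on_def integrable_iff_bounded lp_energy_def)
  then show ?thesis
    unfolding lp_energy_def
    by (subst nn_integral_conv_infsetsum) (auto simp: infsetsum_infsum)
qed

text \<open>Fatou's lemma for the counting measure: the energy is lower semicontinuous under
  pointwise convergence.\<close>

lemma lp_energy_limit_le:
  assumes "0 < p" and "\<And>x. x \<in> A \<Longrightarrow> (\<lambda>n. u n x) \<longlonglongrightarrow> v x"
    and "\<And>n. lp_energy p A (u n) \<le> R n" and "R \<longlonglongrightarrow> r"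
  shows "lp_energy p A v \<le> r"
proof -
  have "lp_energy p A v = (\<integral>\<^sup>+x. liminf (\<lambda>n. ennreal (\<bar>u n x\<bar> powr p)) \<partial>count_space A)"
    unfolding lp_energy_def
  proof (rule nn_integral_cong)
    fix x assume "x \<in> space (count_space A)"
    then have "(\<lambda>n. \<bar>u n x\<bar> powr p) \<longlonglongrightarrow> \<bar>v x\<bar> powr p"
      using assms by (intro tendsto_powr' tendsto_rabs tendsto_const) auto
    then show "ennreal (\<bar>v x\<bar> powr p) = liminf (\<lambda>n. ennreal (\<bar>u n x\<bar> powr p))"
      by (intro lim_imp_Liminf[symmetric] tendsto_ennrealI) auto
  qed
  also have "\<dots> \<le> liminf (\<lambda>n. lp_energy p A (u n))"
    unfolding lp_energy_def by (rule nn_integral_liminf) simp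
  also have "\<dots> \<le> liminf R"
    using assms by (intro Liminf_mono) auto
  also have "\<dots> = r"
    using assms by (simp add: lim_imp_Liminf)
  finally show ?thesis .
qed

lemma lp_energy_finite_tendsto_0:
  fixes e :: "nat \<Rightarrow> 'v"
  assumes "0 < p" "lp_energy p A f < \<infinity>" "inj e" "range e \<subseteq> A"
  shows "(\<lambda>n. f (e n)) \<longlonglongrightarrow> 0"
proof -
  have "lp_energy p UNIV (\<lambda>n. f (e n)) = lp_energy p (range e) f"
    using assms by (intro lp_energy_bij_betw) (auto simp: bij_betw_def)
  also have "\<dots> \<le> lp_energy p A f"
    using assms by (intro lp_energy_mono_set)
  finally have "lp_energy p UNIV (\<lambda>n. f (e n)) < \<infinity>"
    using assms by auto
  then have "summable (\<lambda>n. \<bar>f (e n)\<bar> powr p)"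
    by (subst (asm) lp_energy_finite_summable) (simp add: summable_on_UNIV_nonneg_real_iff)
  then have "(\<lambda>n. \<bar>f (e n)\<bar> powr p) \<longlonglongrightarrow> 0"
    by (rule summable_LIMSEQ_zero)
  then have "(\<lambda>n. (\<bar>f (e n)\<bar> powr p) powr (1 / p)) \<longlonglongrightarrow> 0 powr (1 / p)"
    using assms by (intro tendsto_powr' tendsto_const) auto
  then show ?thesis
    using assms by (simp add: powr_powr tendsto_rabs_zero_iff)
qed

text \<open>On an infinite set at most one constant is at finite distance from f, and it can be read
  off along any injective sequence. Uniqueness and measurability of the constant rest on
  this.\<close>

lemma lp_energy_finite_tendsto:
  fixes e :: "nat \<Rightarrow> 'v"
  assumes "0 < p" "lp_energy p A (\<lambda>x. f x - c) < \<infinity>" "inj e" "range e \<subseteq> A"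
  shows "(\<lambda>n. f (e n)) \<longlonglongrightarrow> c"
  using lp_energy_finite_tendsto_0[OF assms] by (rule LIM_zero_cancel)

text \<open>The p-th power of the norm of the coboundary of f under the right-regular
  representation. Being indexed by group elements and not by edges, it does not refer to a
  generating set.\<close>

definition lp_variation :: "real \<Rightarrow> ('a, 'c) monoid_scheme \<Rightarrow> ('a \<Rightarrow> real) \<Rightarrow> 'a \<Rightarrow> ennreal" where
  "lp_variation p G f g = lp_energy p (carrier G) (\<lambda>x. f (x \<otimes>\<^bsub>G\<^esub> g) - f x)"

context group
begin

lemma bij_betw_r_mult: "g \<in> carrier G \<Longrightarrow> bij_betw (\<lambda>x. x \<otimes> g) (carrier G) (carrier G)"
  by (rule bij_betw_byWitness[where f' = "\<lambda>x. x \<otimes> inv g"]) (auto simp: m_assoc)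

lemma bij_betw_m_inv: "bij_betw (\<lambda>x. inv x) (carrier G) (carrier G)"
  by (rule bij_betw_byWitness[where f' = "\<lambda>x. inv x"]) auto

lemma lp_energy_r_mult:
  "g \<in> carrier G \<Longrightarrow> lp_energy p (carrier G) (\<lambda>x. f (x \<otimes> g)) = lp_energy p (carrier G) f"
  by (rule lp_energy_bij_betw) (rule bij_betw_r_mult)

text \<open>Right translation by g preserves the energy and turns the difference for
  \<open>inv g\<close> into the negative of the one for g.\<close>

lemma lp_variation_inv:
  assumes "g \<in> carrier G"
  shows "lp_variation p G f (inv g) = lp_variation p G f g"
proof -
  have "lp_variation p G f (inv g) = lp_energy p (carrier G) (\<lambda>x. f ((x \<otimes> g) \<otimes> inv g) - f (x \<otimes> g))"
    unfolding lp_variation_def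
    using assms by (intro lp_energy_r_mult[symmetric, where f = "\<lambda>x. f (x \<otimes> inv g) - f x"])
  also have "\<dots> = lp_energy p (carrier G) (\<lambda>x. f x - f (x \<otimes> g))"
    using assms by (intro lp_energy_cong) (simp add: m_assoc)
  also have "\<dots> = lp_variation p G f g"
    unfolding lp_variation_def by (rule lp_energy_minus_commute)
  finally show ?thesis .
qed

lemma lp_variation_one: "lp_variation p G f \<one> = 0"
proof -
  have "lp_variation p G f \<one> = lp_energy p (carrier G) (\<lambda>x. 0)"
    unfolding lp_variation_def by (rule lp_energy_cong) simp
  then show ?thesis by (simp add: lp_energy_def)
qed

text \<open>The choice \<open>t = n\<close> of the weight gives growth \<open>n\<^sup>p\<close> along words of length \<open>n\<close>, which is what
  Minkowski's inequality would give.\<close>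

lemma lp_variation_mult_le:
  assumes "1 \<le> p" "0 < t" "g \<in> carrier G" "h \<in> carrier G"
  shows "lp_variation p G f (g \<otimes> h)
    \<le> ennreal ((t + 1) powr (p - 1)) * (ennreal (t powr (1 - p)) * lp_variation p G f h + lp_variation p G f g)"
proof -
  have "lp_variation p G f (g \<otimes> h) =
      lp_energy p (carrier G) (\<lambda>x. (f ((x \<otimes> g) \<otimes> h) - f (x \<otimes> g)) + (f (x \<otimes> g) - f x))"
    unfolding lp_variation_def using assms by (intro lp_energy_cong) (simp add: m_assoc)
  also have "\<dots> \<le> ennreal ((t + 1) powr (p - 1)) * (ennreal (t powr (1 - p))
      * lp_energy p (carrier G) (\<lambda>x. f ((x \<otimes> g) \<otimes> h) - f (x \<otimes> g)) + lp_variation p G f g)"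
    unfolding lp_variation_def using assms by (intro lp_energy_weighted_add)
  also have "lp_energy p (carrier G) (\<lambda>x. f ((x \<otimes> g) \<otimes> h) - f (x \<otimes> g)) = lp_variation p G f h"
    unfolding lp_variation_def
    using assms by (intro lp_energy_r_mult[where f = "\<lambda>x. f (x \<otimes> h) - f x"])
  finally show ?thesis .
qed

lemma foldr_mult_closed: "set ws \<subseteq> carrier G \<Longrightarrow> foldr (\<lambda>x y. x \<otimes> y) ws \<one> \<in> carrier G"
  by (induction ws) auto

lemma lp_variation_word_le:
  assumes "1 \<le> p" "set ws \<subseteq> carrier G" "\<And>s. s \<in> set ws \<Longrightarrow> lp_variation p G f s \<le> ennreal K" "0 \<le> K"
  shows "lp_variation p G f (foldr (\<lambda>x y. x \<otimes> y) ws \<one>) \<le> ennreal (real (length ws) powr p * K)"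
  using assms(2,3)
proof (induction ws)
  case Nil
  show ?case by (simp add: lp_variation_one)
next
  case (Cons s ws)
  let ?w = "foldr (\<lambda>x y. x \<otimes> y) ws \<one>"
  let ?n = "real (length ws)"
  have mem: "s \<in> carrier G" "?w \<in> carrier G"
    using Cons.prems(1) by (auto intro: foldr_mult_closed)
  have IH: "lp_variation p G f ?w \<le> ennreal (?n powr p * K)"
    using Cons.prems by (intro Cons.IH) auto
  have s: "lp_variation p G f s \<le> ennreal K"
    using Cons.prems by auto
  show ?case
  \<comment> \<open>The weight t is the length of the tail, which has to be positive; a one-letter
    word is therefore treated apart.\<close>
  proof (cases "ws = []")
    case True
    then show ?thesis using s mem by simp
  next
    case False
    then have n: "0 < ?n" by simp
    have "lp_variation p G f (s \<otimes> ?w)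
      \<le> ennreal ((?n + 1) powr (p - 1)) * (ennreal (?n powr (1 - p)) * lp_variation p G f ?w + lp_variation p G f s)"
      by (rule lp_variation_mult_le[OF \<open>1 \<le> p\<close> n mem])
    also have "\<dots> \<le> ennreal ((?n + 1) powr (p - 1)) * (ennreal (?n powr (1 - p)) * ennreal (?n powr p * K) + ennreal K)"
      by (intro mult_left_mono add_mono IH s) auto
    also have "\<dots> = ennreal ((?n + 1) powr (p - 1) * (?n powr (1 - p) * (?n powr p * K) + K))"
      using \<open>0 \<le> K\<close> by (simp add: ennreal_mult)
    also have "?n powr (1 - p) * (?n powr p * K) = ?n * K"
      using n by (simp add: powr_diff)
    also have "(?n + 1) powr (p - 1) * (?n * K + K) = (?n + 1) powr (p - 1) * (?n + 1) * K"
      by (simp add: algebra_simps)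
    also have "(?n + 1) powr (p - 1) * (?n + 1) = real (length (s # ws)) powr p"
      using powr_add[of "?n + 1" "p - 1" 1] by (simp add: add.commute)
    finally show ?thesis by simp
  qed
qed

end

section \<open>Spectral gap of non-amenable groups\<close>

lemma lp_energy_Un_disjoint:
  assumes "A \<inter> B = {}"
  shows "lp_energy p (A \<union> B) f = lp_energy p A f + lp_energy p B f"
proof -
  have "lp_energy p (A \<union> B) f
      = (\<integral>\<^sup>+x. ennreal (\<bar>f x\<bar> powr p) * indicator A x + ennreal (\<bar>f x\<bar> powr p) * indicator B x \<partial>count_space UNIV)"
    unfolding lp_energy_def using assms
    by (subst nn_integral_count_space_indicator) (auto intro!: nn_integral_cong simp: indicator_def)
  also have "\<dots> = lp_energy p A f + lp_energy p B f"
    unfolding lp_energy_def by (simp add: nn_integral_add nn_integral_count_space_indicator)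
  finally show ?thesis .
qed

lemma lp_energy_perturb:
  fixes p \<epsilon> :: real
  assumes "0 < p" "0 < \<epsilon>"
  obtains C where "0 \<le> C"
    "\<And>A f g. lp_energy p A f \<le> ennreal (1 + \<epsilon>) * lp_energy p A g + ennreal C * lp_energy p A (\<lambda>x. f x - g x)"
proof -
  obtain C where C: "0 \<le> C" "\<And>a b d. \<lbrakk>0 \<le> a; 0 \<le> b; 0 \<le> d; a \<le> b + d\<rbrakk> \<Longrightarrow> a powr p \<le> (1 + \<epsilon>) * b powr p + C * d powr p"
    using powr_le_perturb[OF assms] by blast
  have "lp_energy p A f \<le> ennreal (1 + \<epsilon>) * lp_energy p A g + ennreal C * lp_energy p A (\<lambda>x. f x - g x)" for A f g
  proof -
    have *: "\<bar>f x\<bar> powr p \<le> (1 + \<epsilon>) * \<bar>g x\<bar> powr p + C * \<bar>f x - g x\<bar> powr p" for x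
      by (rule C(2)) auto
    have "lp_energy p A f \<le> (\<integral>\<^sup>+x. ennreal (1 + \<epsilon>) * ennreal (\<bar>g x\<bar> powr p)
        + ennreal C * ennreal (\<bar>f x - g x\<bar> powr p) \<partial>count_space A)"
      unfolding lp_energy_def using assms C(1)
      by (intro nn_integral_mono) (rule order_trans[OF ennreal_leI], rule *,
          subst ennreal_plus, auto simp: ennreal_mult)
    also have "\<dots> = ennreal (1 + \<epsilon>) * lp_energy p A g + ennreal C * lp_energy p A (\<lambda>x. f x - g x)"
      by (simp add: lp_energy_def nn_integral_cmult nn_integral_add)
    finally show ?thesis .
  qed
  with C(1) show thesis by (rule that)
qed

section \<open>Invariant means as cluster points\<close>

lemma cluster_point_in_closed:
  assumes "inf (nhds x) F \<noteq> bot" "closed C" "eventually (\<lambda>y. y \<in> C) F"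
  shows "x \<in> C"
proof (rule ccontr)
  assume "x \<notin> C"
  then have "eventually (\<lambda>y. y \<in> - C) (nhds x)"
    using assms(2) by (intro eventually_nhds_in_open) auto
  then have "eventually (\<lambda>y. False) (inf (nhds x) F)"
    using assms(3) by (auto simp: eventually_inf)
  then show False
    using assms(1) by (simp add: eventually_False)
qed

lemma compact_unit_cube: "compact {m :: 'i \<Rightarrow> real. \<forall>i. m i \<in> {0..1}}"
proof -
  have "compactin (product_topology (\<lambda>i::'i. euclideanreal) UNIV) (PiE UNIV (\<lambda>i. {0..1}))"
    by (simp add: compactin_PiE)
  then show ?thesis
    by (simp add: euclidean_product_topology PiE_def Pi_def)
qed

lemma continuous_on_eval [continuous_intros]: "continuous_on S (\<lambda>m :: 'i \<Rightarrow> real. m i)"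
  by (rule continuous_on_product_coordinates[THEN continuous_on_subset]) simp

context group
begin

lemma l_coset_subset_carrier: "\<lbrakk>g \<in> carrier G; A \<subseteq> carrier G\<rbrakk> \<Longrightarrow> g <# A \<subseteq> carrier G"
  by (auto simp: l_coset_def)

text \<open>By Tychonoff's theorem the set functions have a cluster point in a cube. Normalization,
  additivity and invariance up to \<epsilon> are closed conditions on finitely many coordinates, so
  they pass to it. Hence invariance is only required eventually for each set A, with no uniformity
  in A.\<close>

lemma amenable_if_asymptotically_invariant:
  fixes m :: "nat \<Rightarrow> 'a set \<Rightarrow> real"
  assumes gen: "finite_generating_set G T"
    and nonneg: "\<And>n A. A \<subseteq> carrier G \<Longrightarrow> 0 \<le> m n A"
    and total: "\<And>n. m n (carrier G) = 1"
    and add: "\<And>n A B. \<lbrakk>A \<subseteq> carrier G; B \<subseteq> carrier G; A \<inter> B = {}\<rbrakk> \<Longrightarrow> m n (A \<union> B) = m n A + m n B"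
    and inv: "\<And>t A \<epsilon>. \<lbrakk>t \<in> T; A \<subseteq> carrier G; 0 < \<epsilon>\<rbrakk> \<Longrightarrow> \<forall>\<^sub>F n in sequentially. \<bar>m n (t <# A) - m n A\<bar> \<le> \<epsilon>"
  shows "amenable G"
proof -
  have T: "T \<subseteq> carrier G" "generate G T = carrier G"
    using gen by (auto simp: finite_generating_set_def)
  \<comment> \<open>Intersecting with the carrier assigns a value in [0, 1] to every set of the
    type, so that the sequence lies in the compact cube.\<close>
  define M where "M n A = m n (A \<inter> carrier G)" for n A
  have "M n A \<in> {0..1}" for n A
  proof -
    have "1 = m n (A \<inter> carrier G) + m n (carrier G - A)"
    proof -
      have "carrier G = (A \<inter> carrier G) \<union> (carrier G - A)"
        by blast
      then show ?thesis
        using add[of "A \<inter> carrier G" "carrier G - A" n] total[of n] by auto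
    qed
    then show ?thesis
      using nonneg[of "A \<inter> carrier G" n] nonneg[of "carrier G - A" n] by (auto simp: M_def)
  qed
  then have "eventually (\<lambda>x. x \<in> {m. \<forall>i. m i \<in> {0..1}}) (filtermap M sequentially)"
    by (simp add: eventually_filtermap)
  then obtain \<mu> where \<mu>: "\<mu> \<in> {m. \<forall>i. m i \<in> {0..1}}" "inf (nhds \<mu>) (filtermap M sequentially) \<noteq> bot"
    using compact_unit_cube[unfolded compact_filter, rule_format, of "filtermap M sequentially"]
    by (auto simp: filtermap_bot_iff)
  have cluster: "P \<mu>" if "closed (Collect P)" "\<forall>\<^sub>F n in sequentially. P (M n)" for P
    using cluster_point_in_closed[OF \<mu>(2) that(1)] that(2) by (simp add: eventually_filtermap)
  have tot: "\<mu> (carrier G) = 1"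
    by (rule cluster[where P = "\<lambda>\<mu>. \<mu> (carrier G) = 1"]) (auto simp: M_def total intro!: closed_Collect_eq continuous_intros)
  have sum: "\<mu> (A \<union> B) = \<mu> A + \<mu> B" if "A \<subseteq> carrier G" "B \<subseteq> carrier G" "A \<inter> B = {}" for A B
  proof (rule cluster[where P = "\<lambda>\<mu>. \<mu> (A \<union> B) = \<mu> A + \<mu> B"])
    show "closed {\<mu> :: 'a set \<Rightarrow> real. \<mu> (A \<union> B) = \<mu> A + \<mu> B}"
      by (intro closed_Collect_eq continuous_intros)
    have "M n (A \<union> B) = M n A + M n B" for n
      using that add[of A B n] by (simp add: M_def Int_absorb2)
    then show "\<forall>\<^sub>F n in sequentially. M n (A \<union> B) = M n A + M n B"
      by simp
  qed
  have inv_gen: "\<mu> (t <# A) = \<mu> A" if "t \<in> T" "A \<subseteq> carrier G" for t A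
  proof -
    have tA: "t <# A \<subseteq> carrier G"
      using that T by (intro l_coset_subset_carrier) auto
    have "\<bar>\<mu> (t <# A) - \<mu> A\<bar> \<le> \<epsilon>" if "0 < \<epsilon>" for \<epsilon>
    proof (rule cluster[where P = "\<lambda>\<mu>. \<bar>\<mu> (t <# A) - \<mu> A\<bar> \<le> \<epsilon>"])
      show "closed {\<mu> :: 'a set \<Rightarrow> real. \<bar>\<mu> (t <# A) - \<mu> A\<bar> \<le> \<epsilon>}"
        by (intro closed_Collect_le continuous_intros)
      show "\<forall>\<^sub>F n in sequentially. \<bar>M n (t <# A) - M n A\<bar> \<le> \<epsilon>"
        using inv[OF \<open>t \<in> T\<close> \<open>A \<subseteq> carrier G\<close> that] tA \<open>A \<subseteq> carrier G\<close>
        by (simp add: M_def Int_absorb2)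
    qed
    then have "\<bar>\<mu> (t <# A) - \<mu> A\<bar> \<le> 0"
      by (rule field_le_epsilon) simp
    then show ?thesis by simp
  qed
  have "\<mu> (g <# A) = \<mu> A" if "g \<in> generate G T" "A \<subseteq> carrier G" for g A
    using that
  proof (induction arbitrary: A rule: generate.induct)
    case one
    then show ?case by (simp add: lcos_mult_one)
  next
    case (incl h)
    then show ?case by (rule inv_gen)
  next
    case (inv h)
    then have "\<mu> (h <# (inv h <# A)) = \<mu> (inv h <# A)"
      using T by (intro inv_gen l_coset_subset_carrier) auto
    moreover have "h <# (inv h <# A) = A"
      using inv T by (subst lcos_m_assoc) (auto simp: lcos_mult_one)
    ultimately show ?case by simp
  next
    case (eng g h)
    then have "g \<in> carrier G" "h \<in> carrier G"
      using T by auto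
    with eng show ?case
      by (simp add: lcos_m_assoc[symmetric] l_coset_subset_carrier)
  qed
  then show ?thesis
    unfolding amenable_def using \<mu>(1) tot sum T by (intro exI[of _ \<mu>]) auto
qed

text \<open>The variation uses right translations, amenability left ones. Inversion exchanges them,
  since \<open>inv (x \<otimes> t)\<close> is \<open>inv t \<otimes> inv x\<close>.\<close>

lemma lp_energy_inv_coset:
  assumes "t \<in> carrier G" "A \<subseteq> carrier G"
  shows "lp_energy p {x \<in> carrier G. inv x \<in> t <# A} (\<lambda>x. f (x \<otimes> t)) = lp_energy p {x \<in> carrier G. inv x \<in> A} f"
proof (rule lp_energy_bij_betw)
  have *: "inv (x \<otimes> t) \<in> A \<longleftrightarrow> inv x \<in> t <# A" if "x \<in> carrier G" for x
  proof
    assume "inv (x \<otimes> t) \<in> A"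
    moreover have "inv x = t \<otimes> inv (x \<otimes> t)"
      using that assms by (simp add: inv_mult_group m_assoc[symmetric])
    ultimately show "inv x \<in> t <# A"
      by (auto simp: l_coset_def)
  next
    assume "inv x \<in> t <# A"
    then obtain a where a: "a \<in> A" "inv x = t \<otimes> a"
      by (auto simp: l_coset_def)
    then have "inv (x \<otimes> t) = a"
      using that assms by (auto simp: inv_mult_group m_assoc[symmetric])
    with a show "inv (x \<otimes> t) \<in> A" by simp
  qed
  show "bij_betw (\<lambda>x. x \<otimes> t) {x \<in> carrier G. inv x \<in> t <# A} {x \<in> carrier G. inv x \<in> A}"
    using assms by (intro bij_betw_byWitness[where f' = "\<lambda>x. x \<otimes> inv t"])
      (auto simp: m_assoc * simp flip: *)
qed

text \<open>If no constant works, there are functions v n whose variation is arbitrarily small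
  relative to their energy. The measures with density |v n|^p, normalized and pushed forward by
  inversion, are then asymptotically invariant, which makes the group amenable.\<close>

theorem nonamenable_lp_energy_gap:
  assumes gen: "finite_generating_set G T" and "\<not> amenable G" "0 < p"
  obtains C where "\<And>v. lp_energy p (carrier G) v < \<infinity> \<Longrightarrow>
    lp_energy p (carrier G) v \<le> ennreal C * (\<Sum>t\<in>T. lp_variation p G v t)"
proof (rule ccontr)
  assume contra: "\<not> thesis"
  have T: "finite T" "T \<subseteq> carrier G"
    using gen by (auto simp: finite_generating_set_def)
  have "\<exists>v. lp_energy p (carrier G) v < \<infinity> \<and>
    ennreal (real n) * (\<Sum>t\<in>T. lp_variation p G v t) < lp_energy p (carrier G) v" for n :: nat
  proof (rule ccontr)
    assume "\<not> ?thesis"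
    then have "lp_energy p (carrier G) v \<le> ennreal (real n) * (\<Sum>t\<in>T. lp_variation p G v t)"
      if "lp_energy p (carrier G) v < \<infinity>" for v
      using that by (meson not_le)
    then show False
      using contra that by blast
  qed
  then obtain v where fin: "\<And>n. lp_energy p (carrier G) (v n) < \<infinity>"
    and gap: "\<And>n. ennreal (real n) * (\<Sum>t\<in>T. lp_variation p G (v n) t) < lp_energy p (carrier G) (v n)"
    by metis
  define I where "I A = {x \<in> carrier G. inv x \<in> A}" for A
  have I_carrier: "I (carrier G) = carrier G"
    by (auto simp: I_def)
  define W where "W n = enn2real (lp_energy p (carrier G) (v n))" for n
  define e where "e n A = enn2real (lp_energy p (I A) (v n))" for n A
  have energy_I: "lp_energy p (I A) (v n) = ennreal (e n A)" for n A
  proof -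
    have "lp_energy p (I A) (v n) \<le> lp_energy p (carrier G) (v n)"
      by (rule lp_energy_mono_set) (auto simp: I_def)
    with fin[of n] show ?thesis
      by (simp add: e_def)
  qed
  have W: "lp_energy p (carrier G) (v n) = ennreal (W n)" "0 < W n" for n
  proof -
    show "lp_energy p (carrier G) (v n) = ennreal (W n)"
      using fin[of n] by (simp add: W_def)
    \<comment> \<open>\<open>gap\<close> is strict, so the energy is positive and can be divided
      by.\<close>
    then show "0 < W n"
      using le_less_trans[OF zero_le gap[of n]] by simp
  qed
  have e: "0 \<le> e n A" "e n A \<le> W n" for n A
  proof -
    show "0 \<le> e n A" by (simp add: e_def)
    have "lp_energy p (I A) (v n) \<le> lp_energy p (carrier G) (v n)"
      by (rule lp_energy_mono_set) (auto simp: I_def)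
    then show "e n A \<le> W n"
      using W(2)[of n] by (simp add: energy_I W(1))
  qed
  have "amenable G"
  proof (rule amenable_if_asymptotically_invariant[OF gen, where m = "\<lambda>n A. e n A / W n"])
    show "0 \<le> e n A / W n" for n A
      using e(1)[of n A] W(2)[of n] by simp
    show "e n (carrier G) / W n = 1" for n
      using W(2)[of n] by (simp add: e_def W_def I_carrier)
    show "e n (A \<union> B) / W n = e n A / W n + e n B / W n" if "A \<inter> B = {}" for n A B
    proof -
      have "I (A \<union> B) = I A \<union> I B" "I A \<inter> I B = {}"
        using that by (auto simp: I_def)
      then have "ennreal (e n (A \<union> B)) = ennreal (e n A + e n B)"
        by (simp add: energy_I[symmetric] lp_energy_Un_disjoint e)
      then have "e n (A \<union> B) = e n A + e n B"
        using e by (subst (asm) ennreal_inj) auto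
      then show ?thesis by (simp add: add_divide_distrib)
    qed
    show "\<forall>\<^sub>F n in sequentially. \<bar>e n (t <# A) / W n - e n A / W n\<bar> \<le> \<epsilon>"
      if t: "t \<in> T" and A: "A \<subseteq> carrier G" and \<epsilon>: "0 < \<epsilon>" for t A \<epsilon>
    proof -
      \<comment> \<open>Half of \<epsilon> is spent on the factor 1 + \<epsilon> / 2, whose excess
        is at most \<epsilon> / 2 times the total energy \<open>W n\<close>; the other half pays for
        the error \<open>C * s\<close>.\<close>
      obtain C where C: "0 \<le> C" "\<And>(A :: 'a set) f g. lp_energy p A f
          \<le> ennreal (1 + \<epsilon> / 2) * lp_energy p A g + ennreal C * lp_energy p A (\<lambda>x. f x - g x)"
        using lp_energy_perturb[of p "\<epsilon> / 2"] \<open>0 < p\<close> \<epsilon> by auto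
      \<comment> \<open>As \<open>gap\<close> yields \<open>real n * s \<le> W n\<close>, the second
        condition on n makes \<open>C * s\<close> at most \<open>\<epsilon> / 2 * W n\<close>. The
        first one makes the variation finite, as 0 times infinity is 0 in
        \<open>ennreal\<close>.\<close>
      have bound: "\<bar>e n (t <# A) / W n - e n A / W n\<bar> \<le> \<epsilon>" if n: "1 \<le> n" "2 * C / \<epsilon> \<le> real n" for n
      proof -
        define s where "s = enn2real (lp_variation p G (v n) t)"
        let ?B = "I (t <# A)"
        have "ennreal (real n) * lp_variation p G (v n) t \<le> ennreal (real n) * (\<Sum>t\<in>T. lp_variation p G (v n) t)"
          using t T by (intro mult_left_mono member_le_sum) auto
        also note gap
        finally have small: "ennreal (real n) * lp_variation p G (v n) t < ennreal (W n)"
          by (simp add: W)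
        then have "ennreal (real n) * lp_variation p G (v n) t < \<infinity>"
          by (rule less_trans) simp
        then have s: "lp_variation p G (v n) t = ennreal s"
          using n by (auto simp: s_def ennreal_mult_less_top)
        have "0 \<le> s" by (simp add: s_def)
        have ns: "real n * s \<le> W n"
          using small \<open>0 \<le> s\<close> by (simp add: s ennreal_less_iff flip: ennreal_mult)
        have shift: "lp_energy p ?B (\<lambda>x. v n (x \<otimes> t)) = ennreal (e n A)"
          using lp_energy_inv_coset[of t A p "v n"] t T A by (auto simp: I_def energy_I[symmetric])
        have diff: "lp_energy p ?B (\<lambda>x. v n (x \<otimes> t) - v n x) \<le> ennreal s"
          unfolding s[symmetric] lp_variation_def by (rule lp_energy_mono_set) (auto simp: I_def)
        have "ennreal (e n (t <# A)) \<le> ennreal (1 + \<epsilon> / 2) * ennreal (e n A) + ennreal C * ennreal s"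
          using C(2)[of ?B "v n" "\<lambda>x. v n (x \<otimes> t)"] diff
          unfolding energy_I shift lp_energy_minus_commute[of p ?B "v n"]
          by (meson add_left_mono mult_left_mono order_trans zero_le)
        also have "\<dots> = ennreal ((1 + \<epsilon> / 2) * e n A + C * s)"
          using \<epsilon> C(1) \<open>0 \<le> s\<close> e by (simp add: ennreal_mult)
        finally have 1: "e n (t <# A) \<le> (1 + \<epsilon> / 2) * e n A + C * s"
          using \<epsilon> C(1) \<open>0 \<le> s\<close> e by (subst (asm) ennreal_le_iff) auto
        have "ennreal (e n A) \<le> ennreal (1 + \<epsilon> / 2) * ennreal (e n (t <# A)) + ennreal C * ennreal s"
          using C(2)[of ?B "\<lambda>x. v n (x \<otimes> t)" "v n"] diff
          unfolding energy_I shift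
          by (meson add_left_mono mult_left_mono order_trans zero_le)
        also have "\<dots> = ennreal ((1 + \<epsilon> / 2) * e n (t <# A) + C * s)"
          using \<epsilon> C(1) \<open>0 \<le> s\<close> e by (simp add: ennreal_mult)
        finally have 2: "e n A \<le> (1 + \<epsilon> / 2) * e n (t <# A) + C * s"
          using \<epsilon> C(1) \<open>0 \<le> s\<close> e by (subst (asm) ennreal_le_iff) auto
        have "C * s \<le> (\<epsilon> / 2 * real n) * s"
          using n \<epsilon> \<open>0 \<le> s\<close> by (intro mult_right_mono) (auto simp: field_simps)
        also have "\<dots> = \<epsilon> / 2 * (real n * s)" by simp
        also have "\<dots> \<le> \<epsilon> / 2 * W n"
          using ns \<epsilon> by (intro mult_left_mono) auto
        finally have "C * s \<le> \<epsilon> / 2 * W n" .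
        moreover have "\<epsilon> / 2 * e n A' \<le> \<epsilon> / 2 * W n" for A'
          using e \<epsilon> by (intro mult_left_mono) auto
        from this[of A] this[of "t <# A"] calculation 1 2
        have "e n (t <# A) \<le> e n A + \<epsilon> * W n" "e n A \<le> e n (t <# A) + \<epsilon> * W n"
          by (simp_all add: algebra_simps)
        then have "\<bar>e n (t <# A) - e n A\<bar> \<le> \<epsilon> * W n"
          by linarith
        then show ?thesis
          using W(2)[of n] by (simp add: field_simps flip: diff_divide_distrib)
      qed
      have "\<forall>\<^sub>F n in sequentially. 1 \<le> n \<and> 2 * C / \<epsilon> \<le> real n"
        using filterlim_real_sequentially
        by (intro eventually_conj eventually_ge_at_top) (simp add: filterlim_at_top)
      then show ?thesis
        by (rule eventually_mono) (use bound in auto)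
    qed
  qed
  with \<open>\<not> amenable G\<close> show False ..
qed

text \<open>Testing the gap on constant functions.\<close>

corollary nonamenable_infinite:
  assumes "finite_generating_set G T" "\<not> amenable G"
  shows "infinite (carrier G)"
proof
  assume fin: "finite (carrier G)"
  obtain C where C: "\<And>v. lp_energy 1 (carrier G) v < \<infinity> \<Longrightarrow>
    lp_energy 1 (carrier G) v \<le> ennreal C * (\<Sum>t\<in>T. lp_variation 1 G v t)"
    using nonamenable_lp_energy_gap[OF assms, of 1] by auto
  have "lp_energy 1 (carrier G) (\<lambda>_. 1) = of_nat (card (carrier G))"
    using fin by (simp add: lp_energy_def)
  moreover have "lp_variation 1 G (\<lambda>_. 1) t = 0" for t
    by (simp add: lp_variation_def lp_energy_def)
  ultimately have "card (carrier G) = 0"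
    using C[of "\<lambda>_. 1"] by (simp add: of_nat_less_top)
  then show False
    using fin by auto
qed

end

section \<open>Functions of bounded \<open>l\<^sup>p\<close>-variation\<close>

lemma lp_energy_even_midpoint:
  assumes "0 < m"
  shows "2 * (lp_energy (real (2 * m)) A (\<lambda>x. (f x + g x) / 2) + lp_energy (real (2 * m)) A (\<lambda>x. (f x - g x) / 2))
    \<le> lp_energy (real (2 * m)) A f + lp_energy (real (2 * m)) A g"
proof -
  have pow: "\<bar>x\<bar> powr real (2 * m) = x ^ (2 * m)" for x :: real
    using assms by (subst powr_realpow') (auto simp: power_even_abs)
  have "2 * (((f x + g x) / 2) ^ (2 * m) + ((f x - g x) / 2) ^ (2 * m)) \<le> f x ^ (2 * m) + g x ^ (2 * m)" for x
    using even_power_midpoint[OF assms, of "f x" "g x"] by simp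
  from ennreal_leI[OF this]
  have *: "2 * (ennreal (((f x + g x) / 2) ^ (2 * m)) + ennreal (((f x - g x) / 2) ^ (2 * m)))
      \<le> ennreal (f x ^ (2 * m)) + ennreal (g x ^ (2 * m))" for x
    by (simp add: ennreal_mult' zero_le_even_power)
  have "2 * (lp_energy (real (2 * m)) A (\<lambda>x. (f x + g x) / 2) + lp_energy (real (2 * m)) A (\<lambda>x. (f x - g x) / 2))
     = (\<integral>\<^sup>+x. 2 * (ennreal (((f x + g x) / 2) ^ (2 * m)) + ennreal (((f x - g x) / 2) ^ (2 * m))) \<partial>count_space A)"
    unfolding lp_energy_def pow by (simp add: nn_integral_cmult nn_integral_add)
  also have "\<dots> \<le> (\<integral>\<^sup>+x. ennreal (f x ^ (2 * m)) + ennreal (g x ^ (2 * m)) \<partial>count_space A)"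
    by (intro nn_integral_mono *)
  also have "\<dots> = lp_energy (real (2 * m)) A f + lp_energy (real (2 * m)) A g"
    unfolding lp_energy_def pow by (simp add: nn_integral_add)
  finally show ?thesis .
qed

text \<open>The surplus factor |f|^(r - p) is bounded by its value at D. This is how a larger, even
  exponent is reached.\<close>

lemma lp_energy_exponent_mono:
  assumes "0 < p" "p \<le> r" "0 \<le> D" "\<And>x. x \<in> A \<Longrightarrow> \<bar>f x\<bar> \<le> D"
  shows "lp_energy r A f \<le> ennreal (D powr (r - p)) * lp_energy p A f"
proof -
  have *: "\<bar>f x\<bar> powr r \<le> D powr (r - p) * \<bar>f x\<bar> powr p" if "x \<in> A" for x
  proof -
    have "\<bar>f x\<bar> powr r = \<bar>f x\<bar> powr (r - p) * \<bar>f x\<bar> powr p"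
      by (simp flip: powr_add)
    also have "\<dots> \<le> D powr (r - p) * \<bar>f x\<bar> powr p"
      using assms that by (intro mult_right_mono powr_mono2) auto
    finally show ?thesis .
  qed
  have "lp_energy r A f \<le> (\<integral>\<^sup>+x. ennreal (D powr (r - p)) * ennreal (\<bar>f x\<bar> powr p) \<partial>count_space A)"
    unfolding lp_energy_def
    by (intro nn_integral_mono) (auto intro!: ennreal_leI * simp flip: ennreal_mult)
  then show ?thesis
    by (simp add: lp_energy_def nn_integral_cmult)
qed

section \<open>Bounded variation forces a constant at infinity\<close>

context group
begin

text \<open>The p-th power of |f y - f x| is a single summand of the variation at
  \<open>inv x \<otimes> y\<close>.\<close>

lemma oscillation_le_lp_variation:
  assumes "0 < p" "0 \<le> R" "\<And>g. g \<in> carrier G \<Longrightarrow> lp_variation p G f g \<le> ennreal R"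
    and "x \<in> carrier G" "y \<in> carrier G"
  shows "\<bar>f y - f x\<bar> \<le> R powr (1 / p)"
proof -
  have "ennreal (\<bar>f (x \<otimes> (inv x \<otimes> y)) - f x\<bar> powr p) \<le> lp_variation p G f (inv x \<otimes> y)"
    unfolding lp_variation_def
    using assms by (intro le_lp_energy[where f = "\<lambda>z. f (z \<otimes> (inv x \<otimes> y)) - f z"])
  also have "\<dots> \<le> ennreal R"
    using assms by auto
  also have "x \<otimes> (inv x \<otimes> y) = y"
    using assms by (simp flip: m_assoc)
  finally have "\<bar>f y - f x\<bar> powr p \<le> R"
    using assms by (simp add: ennreal_le_iff)
  then have "(\<bar>f y - f x\<bar> powr p) powr (1 / p) \<le> R powr (1 / p)"
    using assms by (intro powr_mono2) auto
  then show ?thesis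
    using assms by (simp add: powr_powr)
qed

text \<open>Minimizing the largest distance to the translates of \<open>f\<close> is the circumcenter argument for the
  affine action on \<open>f + l\<^sup>2\<^sup>m\<close>. By uniform convexity a minimizing sequence is asymptotically
  invariant, so it converges pointwise to a constant.\<close>

lemma bounded_even_variation_imp_const:
  fixes m :: nat and R :: real
  defines "P \<equiv> real (2 * m)"
  assumes "0 < m" and R: "\<And>g. g \<in> carrier G \<Longrightarrow> lp_variation P G f g \<le> ennreal R"
  shows "\<exists>c. lp_energy P (carrier G) (\<lambda>x. f x - c) < \<infinity>"
proof -
  have P: "0 < P" using \<open>0 < m\<close> by (simp add: P_def)
  \<comment> \<open>All functions u compete. Those at infinite distance from f have
    \<open>J u\<close> infinite and do no harm, so the affine space need not be formed.\<close>
  define J where "J u = (SUP g\<in>carrier G. lp_energy P (carrier G) (\<lambda>x. u x - f (x \<otimes> g)))" for u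
  define j where "j = (INF u. J u)"
  have "J f \<le> ennreal R"
    unfolding J_def using R
    by (intro SUP_least) (simp add: lp_variation_def lp_energy_minus_commute[of P _ f])
  then have "j \<le> ennreal R"
    unfolding j_def by (meson INF_lower2 UNIV_I)
  then have j: "j < \<infinity>"
    by (rule le_less_trans) simp
  have "\<exists>u. J u < j + ennreal (1 / Suc n)" for n
  proof -
    have "j < j + ennreal (1 / Suc n)"
      using j by (cases j) (simp_all add: ennreal_less_iff flip: ennreal_plus)
    then show ?thesis
      unfolding j_def by (simp add: INF_less_iff)
  qed
  then obtain u where u: "\<And>n. J (u n) < j + ennreal (1 / Suc n)"
    by metis
  have J_ge: "lp_energy P (carrier G) (\<lambda>x. v x - f (x \<otimes> g)) \<le> J v" if "g \<in> carrier G" for v g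
    unfolding J_def using that by (rule SUP_upper)
  \<comment> \<open>Translating v by k merely permutes the translates of f over which the supremum
    runs.\<close>
  have J_translate: "lp_energy P (carrier G) (\<lambda>x. v (x \<otimes> k) - f (x \<otimes> g)) \<le> J v"
    if "g \<in> carrier G" "k \<in> carrier G" for v g k
  proof -
    have "lp_energy P (carrier G) (\<lambda>x. v (x \<otimes> k) - f (x \<otimes> g))
        = lp_energy P (carrier G) (\<lambda>x. v (x \<otimes> k) - f ((x \<otimes> k) \<otimes> (inv k \<otimes> g)))"
      using that by (intro lp_energy_cong) (simp add: m_assoc, simp flip: m_assoc)
    also have "\<dots> = lp_energy P (carrier G) (\<lambda>x. v x - f (x \<otimes> (inv k \<otimes> g)))"
      using that by (intro lp_energy_r_mult[where f = "\<lambda>x. v x - f (x \<otimes> (inv k \<otimes> g))"])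
    also have "\<dots> \<le> J v"
      using that by (intro J_ge) auto
    finally show ?thesis .
  qed
  \<comment> \<open>The midpoint w of u n and its translate by k is again a competitor, so j <= J w.
    The midpoint inequality gives J w + \<open>?d\<close> <= J (u n), and near-minimality of u n
    leaves at most 1 / (n + 1) for \<open>?d\<close>. Cancelling j uses that it is finite.\<close>
  have almost_inv: "lp_energy P (carrier G) (\<lambda>x. (u n x - u n (x \<otimes> k)) / 2) \<le> ennreal (1 / Suc n)"
    if k: "k \<in> carrier G" for n k
  proof -
    define w where "w x = (u n x + u n (x \<otimes> k)) / 2" for x
    let ?d = "lp_energy P (carrier G) (\<lambda>x. (u n x - u n (x \<otimes> k)) / 2)"
    have "lp_energy P (carrier G) (\<lambda>x. w x - f (x \<otimes> g)) + ?d \<le> J (u n)" if g: "g \<in> carrier G" for g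
    proof -
      have "2 * (lp_energy P (carrier G) (\<lambda>x. w x - f (x \<otimes> g)) + ?d)
        = 2 * (lp_energy P (carrier G) (\<lambda>x. ((u n x - f (x \<otimes> g)) + (u n (x \<otimes> k) - f (x \<otimes> g))) / 2)
          + lp_energy P (carrier G) (\<lambda>x. ((u n x - f (x \<otimes> g)) - (u n (x \<otimes> k) - f (x \<otimes> g))) / 2))"
        by (simp add: w_def field_simps)
      also have "\<dots> \<le> lp_energy P (carrier G) (\<lambda>x. u n x - f (x \<otimes> g))
          + lp_energy P (carrier G) (\<lambda>x. u n (x \<otimes> k) - f (x \<otimes> g))"
        unfolding P_def by (rule lp_energy_even_midpoint) fact
      also have "\<dots> \<le> J (u n) + J (u n)"
        using g k by (intro add_mono J_ge J_translate)
      also have "\<dots> = 2 * J (u n)"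
        by (simp add: mult_2)
      finally show ?thesis
        by (subst (asm) ennreal_mult_le_mult_iff) auto
    qed
    then have "J w + ?d \<le> J (u n)"
      unfolding J_def[of w] by (subst ennreal_SUP_add_left[symmetric]) (auto intro!: SUP_least)
    then have "j + ?d \<le> J (u n)"
      by (rule order_trans[rotated]) (intro add_right_mono, simp add: j_def INF_lower)
    also have "\<dots> \<le> j + ennreal (1 / Suc n)"
      using u by (rule less_imp_le)
    finally show ?thesis
      using j by (auto simp: ennreal_add_left_cancel_le)
  qed
  have diff: "(\<lambda>n. u n \<one> - u n k) \<longlonglongrightarrow> 0" if "k \<in> carrier G" for k
  proof -
    have "ennreal (\<bar>(u n \<one> - u n (\<one> \<otimes> k)) / 2\<bar> powr P) \<le> ennreal (1 / Suc n)" for n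
      by (rule order_trans[OF le_lp_energy[where f = "\<lambda>x. (u n x - u n (x \<otimes> k)) / 2"] almost_inv[OF that]]) simp
    then have "\<bar>(u n \<one> - u n k) / 2\<bar> powr P \<le> 1 / Suc n" for n
      using that by simp
    then have "(\<lambda>n. \<bar>(u n \<one> - u n k) / 2\<bar> powr P) \<longlonglongrightarrow> 0"
      by (intro tendsto_sandwich[OF _ _ tendsto_const LIMSEQ_inverse_real_of_nat])
        (auto simp: inverse_eq_divide)
    then have "(\<lambda>n. (\<bar>(u n \<one> - u n k) / 2\<bar> powr P) powr (1 / P)) \<longlonglongrightarrow> 0 powr (1 / P)"
      using P by (intro tendsto_powr' tendsto_const) auto
    then have "(\<lambda>n. 2 * \<bar>(u n \<one> - u n k) / 2\<bar>) \<longlonglongrightarrow> 2 * 0"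
      using P by (intro tendsto_mult tendsto_const) (simp add: powr_powr)
    then show ?thesis
      by (simp add: tendsto_rabs_zero_iff)
  qed
  have J_bound: "J (u n) \<le> j + 1" for n
  proof -
    have "ennreal (1 / Suc n) \<le> 1" by (simp add: ennreal_le_1)
    with u[of n] show ?thesis
      by (meson add_left_mono less_imp_le order_trans)
  qed
  obtain K where K: "0 \<le> K" "j + 1 = ennreal K"
    using j by (cases "j + 1") auto
  have "\<bar>u n \<one> - f \<one>\<bar> \<le> K powr (1 / P)" for n
  proof -
    have "ennreal (\<bar>u n \<one> - f (\<one> \<otimes> \<one>)\<bar> powr P) \<le> j + 1"
      by (rule order_trans[OF le_lp_energy[where f = "\<lambda>x. u n x - f (x \<otimes> \<one>)"] order_trans[OF J_ge J_bound]]) auto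
    then have "\<bar>u n \<one> - f \<one>\<bar> powr P \<le> K"
      using K by (simp add: ennreal_le_iff)
    then have "(\<bar>u n \<one> - f \<one>\<bar> powr P) powr (1 / P) \<le> K powr (1 / P)"
      using P by (intro powr_mono2) auto
    then show ?thesis
      using P by (simp add: powr_powr)
  qed
  then have "bounded (range (\<lambda>n. u n \<one>))"
    by (auto intro!: boundedI[of _ "\<bar>f \<one>\<bar> + K powr (1 / P)"] simp: abs_le_iff) (smt (verit))+
  \<comment> \<open>A subsequence converging at the identity converges at every k, with the same
    limit, because of \<open>diff\<close>.\<close>
  then obtain c r where r: "strict_mono r" "((\<lambda>n. u n \<one>) \<circ> r) \<longlonglongrightarrow> c"
    using bounded_imp_convergent_subsequence by blast
  have "(\<lambda>n. u (r n) k) \<longlonglongrightarrow> c" if "k \<in> carrier G" for k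
  proof -
    have "(\<lambda>n. u (r n) \<one> - (u (r n) \<one> - u (r n) k)) \<longlonglongrightarrow> c - 0"
      using r(2) LIMSEQ_subseq_LIMSEQ[OF diff[OF that] r(1)] by (intro tendsto_diff) (simp_all add: o_def)
    then show ?thesis by simp
  qed
  note lim = this
  have "lp_energy P (carrier G) (\<lambda>x. c - f (x \<otimes> \<one>)) \<le> j + 1"
  proof (rule lp_energy_limit_le[OF P _ _ tendsto_const])
    show "(\<lambda>n. u (r n) x - f (x \<otimes> \<one>)) \<longlonglongrightarrow> c - f (x \<otimes> \<one>)" if "x \<in> carrier G" for x
      by (intro tendsto_diff tendsto_const lim that)
    show "lp_energy P (carrier G) (\<lambda>x. u (r n) x - f (x \<otimes> \<one>)) \<le> j + 1" for n
      by (rule order_trans[OF J_ge J_bound]) simp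
  qed
  also have "lp_energy P (carrier G) (\<lambda>x. c - f (x \<otimes> \<one>)) = lp_energy P (carrier G) (\<lambda>x. f x - c)"
    by (rule lp_energy_cong) simp
  finally show ?thesis
    unfolding K by (intro exI[of _ c]) (erule le_less_trans, simp)
qed

text \<open>The even exponent yields c. In an infinite group c is the limit of f (x e_n) for every
  x, and the right translates of f by e_n stay within energy R of f at the original exponent p, so
  the same holds for c.\<close>

theorem bounded_lp_variation_imp_const:
  fixes p R :: real
  assumes "infinite (carrier G)" "0 < p" and R: "\<And>g. g \<in> carrier G \<Longrightarrow> lp_variation p G f g \<le> ennreal R"
  shows "\<exists>c. lp_energy p (carrier G) (\<lambda>x. f x - c) < \<infinity>"
proof -
  \<comment> \<open>\<open>R\<close> may be negative, in which case \<open>ennreal R\<close> is 0;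
    the real powers below need a nonnegative bound.\<close>
  define D where "D = max R 0 powr (1 / p)"
  have R': "lp_variation p G f g \<le> ennreal (max R 0)" if "g \<in> carrier G" for g
    using R[OF that] by (rule order_trans) (simp add: ennreal_leI)
  define m where "m = nat \<lceil>p\<rceil>"
  have m: "0 < m" "p \<le> real (2 * m)"
    using \<open>0 < p\<close> by (auto simp: m_def) linarith
  have "lp_variation (real (2 * m)) G f g \<le> ennreal (D powr (real (2 * m) - p) * max R 0)"
    if g: "g \<in> carrier G" for g
  proof -
    have "\<bar>f (x \<otimes> g) - f x\<bar> \<le> D" if "x \<in> carrier G" for x
      unfolding D_def using g that \<open>0 < p\<close> by (intro oscillation_le_lp_variation R') auto
    then have "lp_variation (real (2 * m)) G f g \<le> ennreal (D powr (real (2 * m) - p)) * lp_variation p G f g"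
      unfolding lp_variation_def using m \<open>0 < p\<close>
      by (intro lp_energy_exponent_mono) (simp_all add: D_def)
    also have "\<dots> \<le> ennreal (D powr (real (2 * m) - p)) * ennreal (max R 0)"
      by (intro mult_left_mono R' g) simp
    finally show ?thesis by (simp add: ennreal_mult)
  qed
  from bounded_even_variation_imp_const[OF m(1) this]
  obtain c where c: "lp_energy (real (2 * m)) (carrier G) (\<lambda>x. f x - c) < \<infinity>"
    by blast
  obtain e :: "nat \<Rightarrow> 'a" where e: "inj e" "range e \<subseteq> carrier G"
    using infinite_countable_subset[OF assms(1)] by blast
  have "(\<lambda>n. f (x \<otimes> e n)) \<longlonglongrightarrow> c" if x: "x \<in> carrier G" for x
  proof (rule lp_energy_finite_tendsto[OF _ c])
    show "inj (\<lambda>n. x \<otimes> e n)"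
      using e x by (auto simp: inj_def image_subset_iff)
    show "range (\<lambda>n. x \<otimes> e n) \<subseteq> carrier G"
      using e x by auto
  qed (use m in auto)
  note lim = this
  have "lp_energy p (carrier G) (\<lambda>x. c - f x) \<le> ennreal R"
  proof (rule lp_energy_limit_le[OF \<open>0 < p\<close> _ _ tendsto_const])
    show "(\<lambda>n. f (x \<otimes> e n) - f x) \<longlonglongrightarrow> c - f x" if "x \<in> carrier G" for x
      by (intro tendsto_diff tendsto_const lim that)
    show "lp_energy p (carrier G) (\<lambda>x. f (x \<otimes> e n) - f x) \<le> ennreal R" for n
      using R[of "e n"] e(2) by (auto simp: lp_variation_def)
  qed
  also have "lp_energy p (carrier G) (\<lambda>x. c - f x) = lp_energy p (carrier G) (\<lambda>x. f x - c)"
    by (rule lp_energy_minus_commute)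
  finally show ?thesis
    by (intro exI[of _ c]) (erule le_less_trans, simp)
qed

end

section \<open>Vanishing of \<open>l\<^sup>pH\<^sup>1\<close>\<close>

lemma lp_space_iff: "f \<in> lp_space p V \<longleftrightarrow> f \<in> funs_on V \<and> lp_energy p V f < \<infinity>"
  unfolding lp_space_def lp_energy_finite_summable by simp

lemma lp_energy_Un_le: "lp_energy p (A \<union> B) f \<le> lp_energy p A f + lp_energy p B f"
proof -
  have "lp_energy p (A \<union> B) f = lp_energy p A f + lp_energy p (B - A) f"
    using lp_energy_Un_disjoint[of A "B - A" p f] by simp
  also have "\<dots> \<le> lp_energy p A f + lp_energy p B f"
    by (intro add_left_mono lp_energy_mono_set) auto
  finally show ?thesis .
qed

lemma lp_energy_UN_finite:
  assumes "finite I" "\<And>i. i \<in> I \<Longrightarrow> lp_energy p (A i) f < \<infinity>"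
  shows "lp_energy p (\<Union>i\<in>I. A i) f < \<infinity>"
  using assms
proof (induction I rule: finite_induct)
  case empty
  then show ?case by (simp add: lp_energy_def nn_integral_empty)
next
  case (insert i I)
  have "lp_energy p (\<Union>i\<in>insert i I. A i) f \<le> lp_energy p (A i) f + lp_energy p (\<Union>i\<in>I. A i) f"
    using lp_energy_Un_le by simp
  also have "\<dots> < \<infinity>"
    using insert by (simp add: ennreal_add_less_top)
  finally show ?case .
qed

lemma lp_energy_scale_finite:
  assumes "lp_energy p A f < \<infinity>"
  shows "lp_energy p A (\<lambda>x. a * f x) < \<infinity>"
proof -
  have "lp_energy p A (\<lambda>x. a * f x) = ennreal (\<bar>a\<bar> powr p) * lp_energy p A f"
    by (simp add: lp_energy_def abs_mult powr_mult ennreal_mult nn_integral_cmult)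
  then show ?thesis
    using assms by (simp add: ennreal_mult_less_top)
qed

lemma lp_energy_add_finite:
  assumes "0 \<le> p" "lp_energy p A f < \<infinity>" "lp_energy p A g < \<infinity>"
  shows "lp_energy p A (\<lambda>x. f x + g x) < \<infinity>"
proof -
  note lp_energy_add[OF assms(1), of A f g]
  also have "ennreal (2 powr p) * (lp_energy p A f + lp_energy p A g) < \<infinity>"
    using assms(2,3) by (simp add: ennreal_mult_less_top)
  finally show ?thesis .
qed

lemma module_pointwise_real: "module (\<lambda>(c :: real) (f :: 'v \<Rightarrow> real) x. c * f x)"
  by unfold_locales (auto simp: fun_eq_iff algebra_simps)

text \<open>The sums of an l^p function and a constant already form a subspace, so the span adds
  nothing to them.\<close>

lemma lp_trivial_iff:
  assumes "0 \<le> p"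
  shows "f \<in> lp_trivial p G \<longleftrightarrow>
    f \<in> funs_on (carrier G) \<and> (\<exists>c. lp_energy p (carrier G) (\<lambda>x. f x - c) < \<infinity>)"
proof -
  interpret fun_space: module "\<lambda>(c :: real) (f :: 'a \<Rightarrow> real) x. c * f x"
    by (rule module_pointwise_real)
  let ?V = "carrier G"
  let ?W = "{f \<in> funs_on ?V. \<exists>c. lp_energy p ?V (\<lambda>x. f x - c) < \<infinity>}"
  have "lp_trivial p G \<subseteq> ?W"
    unfolding lp_trivial_def
  proof (rule fun_space.span_minimal)
    have "f \<in> ?W" if "f \<in> lp_space p ?V" for f
      using that by (auto simp: lp_space_iff intro!: exI[of _ 0])
    moreover have "on_set ?V (\<lambda>_. c) \<in> ?W" for c
    proof -
      have "lp_energy p ?V (\<lambda>x. on_set ?V (\<lambda>_. c) x - c) = lp_energy p ?V (\<lambda>_. 0)"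
        by (rule lp_energy_cong) (simp add: on_set_def)
      then show ?thesis
        by (auto simp: funs_on_def on_set_def lp_energy_def intro!: exI[of _ c])
    qed
    ultimately show "lp_space p ?V \<union> range (\<lambda>c. on_set ?V (\<lambda>_. c)) \<subseteq> ?W"
      by blast
    show "fun_space.subspace ?W"
    proof (rule fun_space.subspaceI)
      show "0 \<in> ?W"
        by (auto simp: funs_on_def lp_energy_def intro!: exI[of _ 0])
    next
      fix f g assume "f \<in> ?W" "g \<in> ?W"
      then obtain c d where "f \<in> funs_on ?V" "g \<in> funs_on ?V"
        and cd: "lp_energy p ?V (\<lambda>x. f x - c) < \<infinity>" "lp_energy p ?V (\<lambda>x. g x - d) < \<infinity>"
        by auto
      moreover have "lp_energy p ?V (\<lambda>x. (f + g) x - (c + d)) < \<infinity>"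
        using lp_energy_add_finite[OF assms cd] by (simp add: algebra_simps)
      ultimately show "f + g \<in> ?W"
        by (auto simp: funs_on_def)
    next
      fix a and f assume "f \<in> ?W"
      then obtain c where "f \<in> funs_on ?V" and c: "lp_energy p ?V (\<lambda>x. f x - c) < \<infinity>"
        by auto
      moreover have "lp_energy p ?V (\<lambda>x. a * f x - a * c) < \<infinity>"
        using lp_energy_scale_finite[OF c, of a] by (simp add: algebra_simps)
      ultimately show "(\<lambda>x. a * f x) \<in> ?W"
        by (auto simp: funs_on_def)
    qed
  qed
  moreover have "f \<in> lp_trivial p G" if f: "f \<in> funs_on ?V" and c: "lp_energy p ?V (\<lambda>x. f x - c) < \<infinity>" for c
  proof -
    let ?k = "on_set ?V (\<lambda>_. c)"
    have "lp_energy p ?V (f - ?k) = lp_energy p ?V (\<lambda>x. f x - c)"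
      by (rule lp_energy_cong) (simp add: on_set_def)
    then have "f - ?k \<in> lp_space p ?V"
      using f c by (auto simp: lp_space_iff funs_on_def on_set_def)
    then have "(f - ?k) + ?k \<in> lp_trivial p G"
      unfolding lp_trivial_def by (intro fun_space.span_add fun_space.span_base) auto
    then show ?thesis by simp
  qed
  ultimately show ?thesis by blast
qed

context group
begin

lemma lp_variation_finite_all:
  assumes "finite_generating_set G S" "1 \<le> p" "\<And>s. s \<in> S \<Longrightarrow> lp_variation p G f s < \<infinity>"
    and g: "g \<in> carrier G"
  shows "lp_variation p G f g < \<infinity>"
proof -
  have S: "S \<subseteq> carrier G" "generate G S = carrier G"
    using assms by (auto simp: finite_generating_set_def)
  then have "g \<in> generate G S"
    using g by simp
  then show ?thesis
  proof (induction rule: generate.induct)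
    case one
    then show ?case by (simp add: lp_variation_one)
  next
    case (incl h)
    then show ?case by (rule assms)
  next
    case (inv h)
    then show ?case using assms(3)[OF inv] S by (subst lp_variation_inv) auto
  next
    case (eng g h)
    then have "lp_variation p G f (g \<otimes> h)
        \<le> ennreal ((1 + 1) powr (p - 1)) * (ennreal (1 powr (1 - p)) * lp_variation p G f h + lp_variation p G f g)"
      using S \<open>1 \<le> p\<close> by (intro lp_variation_mult_le) auto
    also have "\<dots> < \<infinity>"
      using eng by (simp add: ennreal_mult_less_top)
    finally show ?case .
  qed
qed

text \<open>The edges labelled by a generator s are a copy of the carrier, and the energy of the
  edge differences over them is the variation at s. Passing on to all g removes the Cayley graph
  from the rest of the proof.\<close>

lemma lp_dirichlet_iff:
  assumes gen: "finite_generating_set G S" and "1 \<le> p"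
  shows "f \<in> lp_dirichlet p G S \<longleftrightarrow>
    f \<in> funs_on (carrier G) \<and> (\<forall>g\<in>carrier G. lp_variation p G f g < \<infinity>)"
proof -
  have S: "finite S" "S \<subseteq> carrier G"
    using gen by (auto simp: finite_generating_set_def)
  let ?E = "cayley_edges G S"
  define E where "E s = (\<lambda>g. (g, g \<otimes> s)) ` carrier G" for s
  have E: "?E = (\<Union>s\<in>S. E s)"
    by (auto simp: cayley_edges_def E_def)
  have energy: "lp_energy p (E s) (edge_diff ?E f) = lp_variation p G f s" if "s \<in> S" for s
  proof -
    have "lp_energy p (E s) (edge_diff ?E f) = lp_energy p (carrier G) (\<lambda>g. edge_diff ?E f (g, g \<otimes> s))"
      by (rule lp_energy_bij_betw[symmetric]) (auto simp: E_def bij_betw_def inj_on_def)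
    also have "\<dots> = lp_variation p G f s"
      unfolding lp_variation_def using that
      by (intro lp_energy_cong) (auto simp: edge_diff_def on_set_def cayley_edges_def)
    finally show ?thesis .
  qed
  have "lp_energy p ?E (edge_diff ?E f) < \<infinity> \<longleftrightarrow> (\<forall>s\<in>S. lp_variation p G f s < \<infinity>)"
  proof
    assume fin: "lp_energy p ?E (edge_diff ?E f) < \<infinity>"
    show "\<forall>s\<in>S. lp_variation p G f s < \<infinity>"
    proof
      fix s assume s: "s \<in> S"
      have "lp_variation p G f s \<le> lp_energy p ?E (edge_diff ?E f)"
        unfolding energy[OF s, symmetric] using s by (intro lp_energy_mono_set) (auto simp: E)
      then show "lp_variation p G f s < \<infinity>"
        using fin by (rule le_less_trans)
    qed
  next
    assume "\<forall>s\<in>S. lp_variation p G f s < \<infinity>"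
    then have "lp_energy p (\<Union>s\<in>S. E s) (edge_diff ?E f) < \<infinity>"
      using S by (intro lp_energy_UN_finite) (auto simp: energy)
    then show "lp_energy p ?E (edge_diff ?E f) < \<infinity>"
      by (simp add: E)
  qed
  also have "\<dots> \<longleftrightarrow> (\<forall>g\<in>carrier G. lp_variation p G f g < \<infinity>)"
    using S lp_variation_finite_all[OF assms] by blast
  finally show ?thesis
    by (auto simp: lp_dirichlet_def lp_space_iff funs_on_def edge_diff_def on_set_def)
qed

text \<open>The zero class is the trivial subspace itself, so the quotient vanishes exactly when
  every Dirichlet function is trivial. The functions f need not be extended by zero outside the
  carrier, so functions along orbits can be inserted directly.\<close>

theorem lpH1_is_zero_iff:
  assumes gen: "finite_generating_set G S" and "1 \<le> p"
  shows "lpH1_is_zero p G S \<longleftrightarrow>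
    (\<forall>f. (\<forall>g\<in>carrier G. lp_variation p G f g < \<infinity>) \<longrightarrow>
      (\<exists>c. lp_energy p (carrier G) (\<lambda>x. f x - c) < \<infinity>))" (is "_ \<longleftrightarrow> ?rhs")
proof -
  interpret fun_space: module "\<lambda>(c :: real) (f :: 'a \<Rightarrow> real) x. c * f x"
    by (rule module_pointwise_real)
  let ?D = "lp_dirichlet p G S" and ?T = "lp_trivial p G"
  let ?r = "{(f, f'). f \<in> ?D \<and> f' \<in> ?D \<and> f - f' \<in> ?T}"
  have p: "0 \<le> p" using \<open>1 \<le> p\<close> by simp
  have T0: "0 \<in> ?T"
    unfolding lp_trivial_def by (rule fun_space.span_zero)
  have Tdiff: "f - g \<in> ?T" if "f \<in> ?T" "g \<in> ?T" for f g
    using that unfolding lp_trivial_def by (rule fun_space.span_diff)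
  have TD: "?T \<subseteq> ?D"
  proof
    fix f assume "f \<in> ?T"
    then obtain c where f: "f \<in> funs_on (carrier G)" and c: "lp_energy p (carrier G) (\<lambda>x. f x - c) < \<infinity>"
      using p by (auto simp: lp_trivial_iff)
    have "lp_variation p G f g < \<infinity>" if g: "g \<in> carrier G" for g
      unfolding lp_variation_def
    proof (rule lp_energy_triangle_finite[OF p])
      show "lp_energy p (carrier G) (\<lambda>x. f (x \<otimes> g) - c) < \<infinity>"
        using lp_energy_r_mult[OF g, of p "\<lambda>x. f x - c"] c by simp
      show "lp_energy p (carrier G) (\<lambda>x. c - f x) < \<infinity>"
        using c lp_energy_minus_commute[of p "carrier G" f "\<lambda>_. c"] by simp
    qed
    with f show "f \<in> ?D"
      by (simp add: lp_dirichlet_iff[OF assms])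
  qed
  have "lpH1_is_zero p G S \<longleftrightarrow> ?D \<subseteq> ?T"
  proof
    assume "lpH1_is_zero p G S"
    then have quot: "?D // ?r = {?T}"
      by (simp add: lpH1_is_zero_def lpH1_def)
    show "?D \<subseteq> ?T"
    proof
      fix f assume f: "f \<in> ?D"
      then have "?r `` {f} = ?T"
        using quot quotientI[of f ?D ?r] by auto
      moreover have "f \<in> ?r `` {f}"
        using f T0 by simp
      ultimately show "f \<in> ?T" by blast
    qed
  next
    assume "?D \<subseteq> ?T"
    with TD have eq: "?D = ?T" by blast
    have "?r `` {f} = ?T" if "f \<in> ?D" for f
      using that Tdiff unfolding eq by auto
    moreover have "?D \<noteq> {}"
      using T0 eq by auto
    ultimately have "?D // ?r = {?T}"
      unfolding quotient_def by auto
    then show "lpH1_is_zero p G S"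
      by (simp add: lpH1_is_zero_def lpH1_def)
  qed
  also have "\<dots> \<longleftrightarrow> ?rhs"
  proof
    assume sub: "?D \<subseteq> ?T"
    show ?rhs
    proof (intro allI impI)
      fix f assume var: "\<forall>g\<in>carrier G. lp_variation p G f g < \<infinity>"
      let ?f = "on_set (carrier G) f"
      have "lp_variation p G ?f g = lp_variation p G f g" if "g \<in> carrier G" for g
        unfolding lp_variation_def using that by (intro lp_energy_cong) (simp add: on_set_def)
      with var have "?f \<in> ?D"
        by (auto simp: lp_dirichlet_iff[OF assms] funs_on_def on_set_def)
      with sub have "?f \<in> ?T" by blast
      then obtain c where "lp_energy p (carrier G) (\<lambda>x. ?f x - c) < \<infinity>"
        using p by (auto simp: lp_trivial_iff)
      also have "lp_energy p (carrier G) (\<lambda>x. ?f x - c) = lp_energy p (carrier G) (\<lambda>x. f x - c)"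
        by (rule lp_energy_cong) (simp add: on_set_def)
      finally show "\<exists>c. lp_energy p (carrier G) (\<lambda>x. f x - c) < \<infinity>" ..
    qed
  next
    assume ?rhs
    then show "?D \<subseteq> ?T"
      using p by (auto simp: lp_dirichlet_iff[OF assms] lp_trivial_iff)
  qed
  finally show ?thesis .
qed

end

section \<open>Actions with a fundamental domain\<close>

lemma borel_measurable_nn_integral_count_space:
  assumes "countable I" and [measurable]: "\<And>i. i \<in> I \<Longrightarrow> u i \<in> borel_measurable M"
  shows "(\<lambda>x. \<integral>\<^sup>+i. u i x \<partial>count_space I) \<in> borel_measurable M"
proof -
  \<comment> \<open>An enumeration of I turns the sum into a series, padded with zeros if I is
    finite.\<close>
  have "(\<integral>\<^sup>+i. u i x \<partial>count_space I)
      = (\<Sum>n. u (from_nat_into I n) x * indicator (to_nat_on I ` I) n)" for x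
  proof -
    have "(\<integral>\<^sup>+i. u i x \<partial>count_space I)
        = (\<integral>\<^sup>+i. u (from_nat_into I (to_nat_on I i)) x \<partial>count_space I)"
      using assms(1) by (intro nn_integral_cong) simp
    also have "\<dots> = (\<integral>\<^sup>+n. u (from_nat_into I n) x \<partial>count_space (to_nat_on I ` I))"
      using assms(1) by (intro nn_integral_bij_count_space) (auto simp: bij_betw_def inj_on_to_nat_on)
    also have "\<dots> = (\<integral>\<^sup>+n. u (from_nat_into I n) x * indicator (to_nat_on I ` I) n \<partial>count_space UNIV)"
      by (simp add: nn_integral_restrict_space[symmetric] restrict_count_space)
    finally show ?thesis
      by (simp add: nn_integral_count_space_nat)
  qed
  moreover have "(\<lambda>x. u (from_nat_into I n) x * indicator (to_nat_on I ` I) n) \<in> borel_measurable M" for n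
  proof (cases "n \<in> to_nat_on I ` I")
    case True
    then have "from_nat_into I n \<in> I"
      using assms(1) by auto
    then show ?thesis by measurable
  qed simp
  ultimately show ?thesis
    by (simp add: borel_measurable_suminf_order)
qed

lemma borel_measurable_lp_energy:
  assumes "countable A" and [measurable]: "\<And>a. a \<in> A \<Longrightarrow> (\<lambda>x. f x a) \<in> borel_measurable M"
  shows "(\<lambda>x. lp_energy p A (f x)) \<in> borel_measurable M"
  unfolding lp_energy_def by (intro borel_measurable_nn_integral_count_space assms(1)) measurable

text \<open>Ensures that the \<open>LEAST\<close> in \<open>word_length\<close> is attained by a
  word.\<close>

lemma (in group) exists_word:
  assumes "g \<in> generate G S" "S \<subseteq> carrier G"
  shows "\<exists>ws. set ws \<subseteq> S \<union> m_inv G ` S \<and> foldr (\<lambda>x y. x \<otimes> y) ws \<one> = g"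
  using assms(1)
proof (induction rule: generate.induct)
  case one
  show ?case by (intro exI[of _ "[]"]) simp
next
  case (incl h)
  then show ?case
    using assms(2) by (intro exI[of _ "[h]"]) auto
next
  case (inv h)
  then show ?case
    using assms(2) by (intro exI[of _ "[inv h]"]) auto
next
  case (eng g h)
  then obtain vs ws where
    ws: "set vs \<subseteq> S \<union> m_inv G ` S" "foldr (\<lambda>x y. x \<otimes> y) vs \<one> = g"
      "set ws \<subseteq> S \<union> m_inv G ` S" "foldr (\<lambda>x y. x \<otimes> y) ws \<one> = h"
    by blast
  have letters: "S \<union> m_inv G ` S \<subseteq> carrier G"
    using assms(2) by auto
  have "foldr (\<lambda>x y. x \<otimes> y) (vs @ ws) \<one> = foldr (\<lambda>x y. x \<otimes> y) vs \<one> \<otimes> foldr (\<lambda>x y. x \<otimes> y) ws \<one>"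
    if "set vs \<subseteq> carrier G" "set ws \<subseteq> carrier G" for vs ws
    using that by (induction vs) (auto simp: foldr_mult_closed[simplified] m_assoc)
  from this[of vs ws] ws letters show ?case
    by (intro exI[of _ "vs @ ws"]) auto
qed

lemma (in group) countable_carrier_if_finitely_generated:
  assumes "finite_generating_set G S"
  shows "countable (carrier G)"
proof (rule countable_subset)
  have S: "finite S" "S \<subseteq> carrier G" "generate G S = carrier G"
    using assms by (auto simp: finite_generating_set_def)
  show "carrier G \<subseteq> (\<lambda>ws. foldr (\<lambda>x y. x \<otimes> y) ws \<one>) ` lists (S \<union> m_inv G ` S)"
    using exists_word[of _ S] S by (fastforce simp: in_lists_conv_set)
  show "countable ((\<lambda>ws. foldr (\<lambda>x y. x \<otimes> y) ws \<one>) ` lists (S \<union> m_inv G ` S))"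
    using S by (intro countable_image countable_lists countable_finite) auto
qed

text \<open>A shortest word for g is fed into \<open>lp_variation_word_le\<close>. Summing the
  variations of the finitely many letters gives one K above each of them.\<close>

lemma (in group) lp_variation_le_word_length:
  assumes gen: "finite_generating_set G S" and "1 \<le> p"
    and fin: "\<And>g. g \<in> carrier G \<Longrightarrow> lp_variation p G f g < \<infinity>"
  obtains K where "0 \<le> K"
    "\<And>g. g \<in> carrier G \<Longrightarrow> lp_variation p G f g \<le> ennreal (K * real (word_length G S g) powr p)"
proof -
  have S: "finite S" "S \<subseteq> carrier G" "generate G S = carrier G"
    using gen by (auto simp: finite_generating_set_def)
  let ?A = "S \<union> m_inv G ` S"
  have A: "finite ?A" "?A \<subseteq> carrier G"
    using S by auto
  define K where "K = (\<Sum>s\<in>?A. enn2real (lp_variation p G f s))"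
  have K: "0 \<le> K"
    unfolding K_def by (intro sum_nonneg) simp
  have var_A: "lp_variation p G f s \<le> ennreal K" if "s \<in> ?A" for s
  proof -
    have "lp_variation p G f s = ennreal (enn2real (lp_variation p G f s))"
      using fin[of s] A that by (intro ennreal_enn2real[symmetric]) auto
    also have "\<dots> \<le> ennreal K"
      unfolding K_def using A(1) that by (intro ennreal_leI member_le_sum) auto
    finally show ?thesis .
  qed
  have "lp_variation p G f g \<le> ennreal (K * real (word_length G S g) powr p)" if "g \<in> carrier G" for g
  proof -
    have "\<exists>ws. length ws = word_length G S g \<and> set ws \<subseteq> ?A \<and> foldr (\<lambda>x y. x \<otimes> y) ws \<one> = g"
      unfolding word_length_def
      by (rule LeastI_ex) (use exists_word[of g S] S that in auto)
    then obtain ws where ws: "length ws = word_length G S g" "set ws \<subseteq> ?A" "foldr (\<lambda>x y. x \<otimes> y) ws \<one> = g"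
      by blast
    have "lp_variation p G f (foldr (\<lambda>x y. x \<otimes> y) ws \<one>) \<le> ennreal (real (length ws) powr p * K)"
      using ws(2) A(2) var_A K by (intro lp_variation_word_le \<open>1 \<le> p\<close>) auto
    then show ?thesis
      by (simp only: ws mult.commute)
  qed
  with K show thesis by (rule that)
qed

section \<open>Return map and unfolding over a fundamental domain\<close>

locale fundamental_action = group G for G (structure) +
  fixes M :: "'x measure" and \<phi> :: "'a \<Rightarrow> 'x \<Rightarrow> 'x" and D :: "'x set"
  assumes action: "free_mp_action G M \<phi>"
    and domain: "finite_fundamental_domain G M \<phi> D"
    and countable_carrier: "countable (carrier G)"
begin

lemma act_closed: "\<lbrakk>g \<in> carrier G; x \<in> space M\<rbrakk> \<Longrightarrow> \<phi> g x \<in> space M"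
  using action group_action.element_image by (fastforce simp: free_mp_action_def)

lemma act_mult: "\<lbrakk>g \<in> carrier G; h \<in> carrier G; x \<in> space M\<rbrakk> \<Longrightarrow> \<phi> (g \<otimes> h) x = \<phi> g (\<phi> h x)"
  using action group_action.composition_rule by (fastforce simp: free_mp_action_def)

lemma act_one: "x \<in> space M \<Longrightarrow> \<phi> \<one> x = x"
  using action group_action.id_eq_one[of G "space M" \<phi>] by (metis free_mp_action_def restrict_apply')

lemma act_inv_cancel:
  "\<lbrakk>g \<in> carrier G; x \<in> space M\<rbrakk> \<Longrightarrow> \<phi> (inv g) (\<phi> g x) = x"
  "\<lbrakk>g \<in> carrier G; x \<in> space M\<rbrakk> \<Longrightarrow> \<phi> g (\<phi> (inv g) x) = x"
  by (simp_all flip: act_mult add: act_one)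

lemma measurable_act [measurable (raw)]: "g \<in> carrier G \<Longrightarrow> \<phi> g \<in> measurable M M"
  using action by (simp add: free_mp_action_def)

lemma distr_act: "g \<in> carrier G \<Longrightarrow> distr M M (\<phi> g) = M"
  using action by (simp add: free_mp_action_def)

lemma sets_domain [measurable]: "D \<in> sets M"
  using domain by (simp add: finite_fundamental_domain_def)

lemma domain_subset: "D \<subseteq> space M"
  using sets_domain by (rule sets.sets_into_space)

lemma emeasure_domain_finite: "emeasure M D < \<infinity>"
  using domain by (simp add: finite_fundamental_domain_def)

lemma nn_integral_act:
  assumes "g \<in> carrier G" "u \<in> borel_measurable M"
  shows "(\<integral>\<^sup>+x. u (\<phi> g x) \<partial>M) = (\<integral>\<^sup>+x. u x \<partial>M)"
  using nn_integral_distr[OF measurable_act[OF assms(1)], of u] assms by (simp add: distr_act)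

lemma AE_act:
  assumes "g \<in> carrier G" "AE x in M. P x"
  shows "AE x in M. P (\<phi> g x)"
proof (rule AE_distrD[OF measurable_act[OF assms(1)]])
  show "AE x in distr M M (\<phi> g). P x"
    using assms(2) by (simp only: distr_act[OF assms(1)])
qed

text \<open>The cocycle value \<open>ME_cocycle G \<psi> \<phi> D h x\<close> is \<open>return (\<psi> h x)\<close>.\<close>

definition return :: "'x \<Rightarrow> 'a" where
  "return x = (THE g. g \<in> carrier G \<and> \<phi> g x \<in> D)"

text \<open>Existence is the covering property of the translates of D, uniqueness their
  disjointness.\<close>

lemma ex1_return:
  assumes x: "x \<in> space M"
  shows "\<exists>!g. g \<in> carrier G \<and> \<phi> g x \<in> D"
proof (rule ex_ex1I)
  obtain g d where "g \<in> carrier G" "d \<in> D" "x = \<phi> g d"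
    using x domain unfolding finite_fundamental_domain_def by blast
  then show "\<exists>g. g \<in> carrier G \<and> \<phi> g x \<in> D"
    using domain_subset by (intro exI[of _ "inv g"]) (auto simp: act_inv_cancel)
next
  fix g h assume g: "g \<in> carrier G \<and> \<phi> g x \<in> D" and h: "h \<in> carrier G \<and> \<phi> h x \<in> D"
  have "x \<in> \<phi> (inv g) ` D" "x \<in> \<phi> (inv h) ` D"
    using g h x act_inv_cancel(1)[of g x] act_inv_cancel(1)[of h x] by (metis imageI)+
  moreover have "disjoint_family_on (\<lambda>g. \<phi> g ` D) (carrier G)"
    using domain by (simp add: finite_fundamental_domain_def)
  ultimately have "inv g = inv h"
    using g h by (auto simp: disjoint_family_on_def)
  then show "g = h"
    using g h by (metis inv_inv)
qed

lemma return_closed: "x \<in> space M \<Longrightarrow> return x \<in> carrier G"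
  and act_return: "x \<in> space M \<Longrightarrow> \<phi> (return x) x \<in> D"
  using theI'[OF ex1_return] by (auto simp: return_def)

lemma return_eqI: "\<lbrakk>x \<in> space M; g \<in> carrier G; \<phi> g x \<in> D\<rbrakk> \<Longrightarrow> return x = g"
  using ex1_return return_closed act_return by blast

lemma return_eq_iff: "\<lbrakk>x \<in> space M; g \<in> carrier G\<rbrakk> \<Longrightarrow> return x = g \<longleftrightarrow> \<phi> g x \<in> D"
  using return_eqI act_return by blast

lemma return_domain: "x \<in> D \<Longrightarrow> return x = \<one>"
  using domain_subset by (intro return_eqI) (auto simp: act_one)

lemma return_act:
  assumes "x \<in> space M" "k \<in> carrier G"
  shows "return (\<phi> k x) = return x \<otimes> inv k"
proof (rule return_eqI)
  have "\<phi> (return x \<otimes> inv k) (\<phi> k x) = \<phi> (return x) x"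
    using assms by (simp add: act_mult act_closed return_closed act_inv_cancel)
  then show "\<phi> (return x \<otimes> inv k) (\<phi> k x) \<in> D"
    using assms by (simp add: act_return)
qed (use assms in \<open>auto simp: act_closed return_closed\<close>)

lemma measurable_return [measurable]: "return \<in> measurable M (count_space (carrier G))"
proof (subst measurable_count_space_eq_countable[OF countable_carrier], intro conjI ballI)
  show "return \<in> space M \<rightarrow> carrier G"
    by (simp add: return_closed)
  fix g assume g: "g \<in> carrier G"
  then have "return -` {g} \<inter> space M = \<phi> g -` D \<inter> space M"
    by (auto simp: return_eq_iff[symmetric])
  also have "\<dots> \<in> sets M"
    using g by measurable
  finally show "return -` {g} \<inter> space M \<in> sets M" .
qed

lemma nn_integral_return_indicator:
  assumes "x \<in> space M"
  shows "(\<integral>\<^sup>+g. indicator D (\<phi> g x) \<partial>count_space (carrier G)) = (1 :: ennreal)"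
proof -
  have "(\<integral>\<^sup>+g. indicator D (\<phi> g x) \<partial>count_space (carrier G))
      = (\<integral>\<^sup>+g. indicator {return x} g \<partial>count_space (carrier G) :: ennreal)"
    using assms by (intro nn_integral_cong) (auto simp: indicator_def return_eq_iff[symmetric])
  also have "\<dots> = 1"
    using assms by (simp add: return_closed)
  finally show ?thesis .
qed

text \<open>Every orbit meets D exactly once, so the indicators of the translates of D form a
  partition of unity. It is inserted, the sum is exchanged with the integral, and each term is moved
  to D by invariance of the measure.\<close>

lemma nn_integral_unfold:
  assumes [measurable]: "u \<in> borel_measurable M"
  shows "(\<integral>\<^sup>+x. u x \<partial>M) = (\<integral>\<^sup>+x\<in>D. (\<integral>\<^sup>+g. u (\<phi> g x) \<partial>count_space (carrier G)) \<partial>M)"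
proof -
  have "(\<integral>\<^sup>+x. u x \<partial>M) = (\<integral>\<^sup>+x. (\<integral>\<^sup>+g. u x * indicator D (\<phi> g x) \<partial>count_space (carrier G)) \<partial>M)"
    by (intro nn_integral_cong) (simp add: nn_integral_cmult nn_integral_return_indicator)
  also have "\<dots> = (\<integral>\<^sup>+g. (\<integral>\<^sup>+x. u x * indicator D (\<phi> g x) \<partial>M) \<partial>count_space (carrier G))"
    by (intro nn_integral_count_space_nn_integral countable_carrier) measurable
  also have "\<dots> = (\<integral>\<^sup>+g. (\<integral>\<^sup>+x. u (\<phi> (inv g) x) * indicator D x \<partial>M) \<partial>count_space (carrier G))"
  proof (rule nn_integral_cong)
    fix g assume "g \<in> space (count_space (carrier G))"
    then have g: "g \<in> carrier G" by simp
    then have "(\<integral>\<^sup>+x. u x * indicator D (\<phi> g x) \<partial>M)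
        = (\<integral>\<^sup>+x. u (\<phi> (inv g) x) * indicator D (\<phi> g (\<phi> (inv g) x)) \<partial>M)"
      by (intro nn_integral_act[symmetric, where u = "\<lambda>x. u x * indicator D (\<phi> g x)"]) measurable
    also have "\<dots> = (\<integral>\<^sup>+x. u (\<phi> (inv g) x) * indicator D x \<partial>M)"
      using g by (intro nn_integral_cong) (simp add: act_inv_cancel)
    finally show "(\<integral>\<^sup>+x. u x * indicator D (\<phi> g x) \<partial>M)
        = (\<integral>\<^sup>+x. u (\<phi> (inv g) x) * indicator D x \<partial>M)" .
  qed
  also have "\<dots> = (\<integral>\<^sup>+g. (\<integral>\<^sup>+x. u (\<phi> g x) * indicator D x \<partial>M) \<partial>count_space (carrier G))"
    by (rule nn_integral_bij_count_space[OF bij_betw_m_inv])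
  also have "\<dots> = (\<integral>\<^sup>+x. (\<integral>\<^sup>+g. u (\<phi> g x) * indicator D x \<partial>count_space (carrier G)) \<partial>M)"
    by (intro nn_integral_count_space_nn_integral[symmetric] countable_carrier) measurable
  also have "\<dots> = (\<integral>\<^sup>+x\<in>D. (\<integral>\<^sup>+g. u (\<phi> g x) \<partial>count_space (carrier G)) \<partial>M)"
    by (intro nn_integral_cong) (simp add: nn_integral_multc)
  finally show ?thesis .
qed

text \<open>If D were null, unfolding the constant 1 would make the whole space null.\<close>

lemma emeasure_domain_pos:
  assumes "emeasure M (space M) \<noteq> 0"
  shows "emeasure M D \<noteq> 0"
proof
  assume "emeasure M D = 0"
  then have "AE x in M. x \<notin> D"
    by (intro AE_not_in) (simp add: null_sets_def)
  then have "AE x in M. (\<integral>\<^sup>+g. 1 \<partial>count_space (carrier G)) * indicator D x = (0 :: ennreal)"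
    by eventually_elim simp
  then have "(\<integral>\<^sup>+x\<in>D. (\<integral>\<^sup>+g. 1 \<partial>count_space (carrier G)) \<partial>M) = (\<integral>\<^sup>+x. 0 \<partial>M)"
    by (rule nn_integral_cong_AE)
  then have "(\<integral>\<^sup>+x. 1 \<partial>M) = 0"
    using nn_integral_unfold[of "\<lambda>_. 1"] by simp
  with assms show False by simp
qed

text \<open>The exceptional set spreads from D to countably many translates, and these cover the
  space.\<close>

lemma AE_from_domain:
  assumes "AE x in M. x \<in> D \<longrightarrow> P x"
    and inv: "\<And>g x. \<lbrakk>g \<in> carrier G; x \<in> space M; P x\<rbrakk> \<Longrightarrow> P (\<phi> g x)"
  shows "AE x in M. P x"
proof -
  have "AE x in M. \<forall>g\<in>carrier G. \<phi> g x \<in> D \<longrightarrow> P (\<phi> g x)"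
    using assms(1) by (intro AE_ball_countable[THEN iffD2] countable_carrier ballI AE_act[where P = "\<lambda>x. x \<in> D \<longrightarrow> P x"])
  then show ?thesis
    using AE_space
  proof eventually_elim
    case (elim x)
    then have "P (\<phi> (return x) x)"
      by (auto simp: return_closed act_return)
    then have "P (\<phi> (inv (return x)) (\<phi> (return x) x))"
      using elim by (auto intro: inv[of "inv (return x)" "\<phi> (return x) x"] simp: return_closed act_closed)
    then show ?case
      using elim by (simp add: act_inv_cancel return_closed)
  qed
qed

end

section \<open>Couplings\<close>

locale coupling =
  GA: fundamental_action G M \<phi> XG + HA: fundamental_action H M \<psi> XH
  for G :: "('a, 'c) monoid_scheme" and H :: "('b, 'd) monoid_scheme"
    and M :: "'x measure" and \<phi> \<psi> XG XH +
  assumes commute: "\<lbrakk>g \<in> carrier G; h \<in> carrier H; x \<in> space M\<rbrakk> \<Longrightarrow> \<phi> g (\<psi> h x) = \<psi> h (\<phi> g x)"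
begin

text \<open>G preserves the measure of X / H, modelled on \<open>XH\<close>: as the actions commute,
  every translate of \<open>XH\<close> by G is again a fundamental domain of H, and an H-invariant
  function has the same integral over all of them.\<close>

lemma nn_integral_invariant:
  assumes [measurable]: "u \<in> borel_measurable M"
    and inv: "\<And>h x. \<lbrakk>h \<in> carrier H; x \<in> space M\<rbrakk> \<Longrightarrow> u (\<psi> h x) = u x"
    and k: "k \<in> carrier G"
  shows "(\<integral>\<^sup>+x\<in>XH. u (\<phi> k x) \<partial>M) = (\<integral>\<^sup>+x\<in>XH. u x \<partial>M)"
proof -
  have k': "inv\<^bsub>G\<^esub> k \<in> carrier G"
    using k by simp
  have [measurable]: "(\<lambda>x. indicator XH (\<phi> (inv\<^bsub>G\<^esub> k) x) :: ennreal) \<in> borel_measurable M"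
    by (rule measurable_compose[OF GA.measurable_act[OF k']]) measurable
  have "(\<integral>\<^sup>+x\<in>XH. u (\<phi> k x) \<partial>M) = (\<integral>\<^sup>+x. u (\<phi> k x) * indicator XH (\<phi> (inv\<^bsub>G\<^esub> k) (\<phi> k x)) \<partial>M)"
    using k by (intro nn_integral_cong) (simp add: GA.act_inv_cancel)
  also have "\<dots> = (\<integral>\<^sup>+x. u x * indicator XH (\<phi> (inv\<^bsub>G\<^esub> k) x) \<partial>M)"
    by (rule GA.nn_integral_act[OF k]) measurable
  also have "\<dots> = (\<integral>\<^sup>+x\<in>XH. (\<integral>\<^sup>+h. u (\<psi> h x) * indicator XH (\<phi> (inv\<^bsub>G\<^esub> k) (\<psi> h x)) \<partial>count_space (carrier H)) \<partial>M)"
    by (rule HA.nn_integral_unfold) measurable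
  also have "\<dots> = (\<integral>\<^sup>+x\<in>XH. u x \<partial>M)"
  proof (rule nn_integral_cong)
    fix x assume x: "x \<in> space M"
    have "(\<integral>\<^sup>+h. u (\<psi> h x) * indicator XH (\<phi> (inv\<^bsub>G\<^esub> k) (\<psi> h x)) \<partial>count_space (carrier H))
        = (\<integral>\<^sup>+h. u x * indicator XH (\<psi> h (\<phi> (inv\<^bsub>G\<^esub> k) x)) \<partial>count_space (carrier H))"
      using x k' by (intro nn_integral_cong) (simp add: inv commute)
    also have "\<dots> = u x"
      using x k' by (simp add: nn_integral_cmult HA.nn_integral_return_indicator GA.act_closed)
    finally show "(\<integral>\<^sup>+h. u (\<psi> h x) * indicator XH (\<phi> (inv\<^bsub>G\<^esub> k) (\<psi> h x)) \<partial>count_space (carrier H)) * indicator XH x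
        = u x * indicator XH x"
      by simp
  qed
  finally show ?thesis .
qed

text \<open>If x = g y with y in \<open>XG\<close>, then \<open>GA.return x\<close> carries x back
  to y and is the inverse of g; hence the inversion.\<close>

definition induced :: "('a \<Rightarrow> real) \<Rightarrow> 'x \<Rightarrow> real" where
  "induced f x = f (inv\<^bsub>G\<^esub> (GA.return x))"

lemma measurable_induced [measurable]: "induced f \<in> borel_measurable M"
  unfolding induced_def
  by (rule measurable_compose[OF GA.measurable_return]) simp

lemma induced_act:
  assumes "g \<in> carrier G" "x \<in> space M"
  shows "induced f (\<phi> g x) = f (g \<otimes>\<^bsub>G\<^esub> inv\<^bsub>G\<^esub> (GA.return x))"
  using assms by (simp add: induced_def GA.return_act GA.return_closed GA.inv_mult_group)

lemma induced_act_domain: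
  assumes "g \<in> carrier G" "y \<in> XG"
  shows "induced f (\<phi> g y) = f g"
  using assms GA.domain_subset by (auto simp: induced_act GA.return_domain)

lemma measurable_displacement:
  assumes "h \<in> carrier H" and [measurable]: "F \<in> borel_measurable M"
  shows "(\<lambda>x. ennreal (\<bar>F (\<psi> h x) - F x\<bar> powr p)) \<in> borel_measurable M"
proof -
  have [measurable]: "(\<lambda>x. F (\<psi> h x)) \<in> borel_measurable M"
    by (rule measurable_compose[OF HA.measurable_act[OF assms(1)]]) measurable
  show ?thesis by measurable
qed

text \<open>Unfold over G. Since h commutes with g, the displacement at g y is f (g b) - f g, where
  b is the inverse of the cocycle value at y. Summing over g gives the variation at b, which equals
  that at the cocycle value.\<close>

lemma nn_integral_induced_displacement:
  assumes h: "h \<in> carrier H"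
  shows "(\<integral>\<^sup>+x. ennreal (\<bar>induced f (\<psi> h x) - induced f x\<bar> powr p) \<partial>M)
    = (\<integral>\<^sup>+y\<in>XG. lp_variation p G f (ME_cocycle G \<psi> \<phi> XG h y) \<partial>M)"
proof -
  have "(\<integral>\<^sup>+x. ennreal (\<bar>induced f (\<psi> h x) - induced f x\<bar> powr p) \<partial>M)
    = (\<integral>\<^sup>+y\<in>XG. (\<integral>\<^sup>+g. ennreal (\<bar>induced f (\<psi> h (\<phi> g y)) - induced f (\<phi> g y)\<bar> powr p)
        \<partial>count_space (carrier G)) \<partial>M)"
    using h by (intro GA.nn_integral_unfold measurable_displacement) measurable
  also have "\<dots> = (\<integral>\<^sup>+y\<in>XG. lp_variation p G f (ME_cocycle G \<psi> \<phi> XG h y) \<partial>M)"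
  proof (rule nn_integral_cong)
    fix y assume y: "y \<in> space M"
    have \<beta>: "ME_cocycle G \<psi> \<phi> XG h y = GA.return (\<psi> h y)"
      by (simp add: ME_cocycle_def GA.return_def)
    have hy: "\<psi> h y \<in> space M"
      using h y by (rule HA.act_closed)
    have "lp_energy p (carrier G) (\<lambda>g. induced f (\<psi> h (\<phi> g y)) - induced f (\<phi> g y))
        = lp_variation p G f (GA.return (\<psi> h y))" if "y \<in> XG"
    proof -
      have "lp_energy p (carrier G) (\<lambda>g. induced f (\<psi> h (\<phi> g y)) - induced f (\<phi> g y))
          = lp_variation p G f (inv\<^bsub>G\<^esub> (GA.return (\<psi> h y)))"
        unfolding lp_variation_def using h y hy that
        by (intro lp_energy_cong) (simp add: induced_act_domain induced_act flip: commute)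
      then show ?thesis
        using hy by (simp add: GA.lp_variation_inv GA.return_closed)
    qed
    then show "(\<integral>\<^sup>+g. ennreal (\<bar>induced f (\<psi> h (\<phi> g y)) - induced f (\<phi> g y)\<bar> powr p) \<partial>count_space (carrier G))
          * indicator XG y
        = lp_variation p G f (ME_cocycle G \<psi> \<phi> XG h y) * indicator XG y"
      by (auto simp: \<beta> lp_energy_def indicator_def)
  qed
  finally show ?thesis .
qed

lemma induced_displacement_finite:
  assumes gen: "finite_generating_set G S" and p: "1 \<le> p" "p \<le> q"
    and fin: "\<And>g. g \<in> carrier G \<Longrightarrow> lp_variation p G f g < \<infinity>"
    and h: "h \<in> carrier H"
    and integrable: "(\<integral>\<^sup>+x\<in>XG. ennreal (real (word_length G S (ME_cocycle G \<psi> \<phi> XG h x)) powr q) \<partial>M) < \<infinity>"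
  shows "(\<integral>\<^sup>+x. ennreal (\<bar>induced f (\<psi> h x) - induced f x\<bar> powr p) \<partial>M) < \<infinity>"
proof -
  obtain K where K: "0 \<le> K"
    "\<And>g. g \<in> carrier G \<Longrightarrow> lp_variation p G f g \<le> ennreal (K * real (word_length G S g) powr p)"
    using GA.lp_variation_le_word_length[OF gen p(1) fin] by blast
  let ?\<beta> = "\<lambda>y. ME_cocycle G \<psi> \<phi> XG h y"
  have \<beta>: "?\<beta> = (\<lambda>y. GA.return (\<psi> h y))"
    by (simp add: ME_cocycle_def GA.return_def fun_eq_iff)
  \<comment> \<open>Word lengths are natural numbers, hence 0 or at least 1, so the exponents
    compare pointwise.\<close>
  have pow_mono: "real n powr p \<le> real n powr q" for n
    using p by (cases "n = 0") (auto intro: powr_mono)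
  have [measurable]: "(\<lambda>y. ennreal (real (word_length G S (?\<beta> y)) powr q)) \<in> borel_measurable M"
    unfolding \<beta>
    by (rule measurable_compose[OF measurable_compose[OF HA.measurable_act[OF h] GA.measurable_return]]) simp
  have "(\<integral>\<^sup>+x. ennreal (\<bar>induced f (\<psi> h x) - induced f x\<bar> powr p) \<partial>M)
      = (\<integral>\<^sup>+y\<in>XG. lp_variation p G f (?\<beta> y) \<partial>M)"
    by (rule nn_integral_induced_displacement[OF h])
  also have "\<dots> \<le> (\<integral>\<^sup>+y. ennreal K * (ennreal (real (word_length G S (?\<beta> y)) powr q) * indicator XG y) \<partial>M)"
  proof (rule nn_integral_mono)
    fix y assume y: "y \<in> space M"
    then have "?\<beta> y \<in> carrier G"
      using h by (simp add: \<beta> GA.return_closed HA.act_closed)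
    then have "lp_variation p G f (?\<beta> y) \<le> ennreal (K * real (word_length G S (?\<beta> y)) powr p)"
      by (rule K(2))
    also have "\<dots> \<le> ennreal (K * real (word_length G S (?\<beta> y)) powr q)"
      using K(1) pow_mono by (intro ennreal_leI mult_left_mono)
    also have "\<dots> = ennreal K * ennreal (real (word_length G S (?\<beta> y)) powr q)"
      using K(1) by (simp add: ennreal_mult)
    finally show "lp_variation p G f (?\<beta> y) * indicator XG y
        \<le> ennreal K * (ennreal (real (word_length G S (?\<beta> y)) powr q) * indicator XG y)"
      by (simp add: indicator_def)
  qed
  also have "\<dots> = ennreal K * (\<integral>\<^sup>+y\<in>XG. ennreal (real (word_length G S (?\<beta> y)) powr q) \<partial>M)"
    by (rule nn_integral_cmult) measurable
  also have "\<dots> < \<infinity>"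
    using integrable by (simp add: ennreal_mult_less_top)
  finally show ?thesis .
qed

text \<open>The function \<open>c\<close> is the value at infinity of \<open>F\<close> along the \<open>H\<close>-orbits.\<close>

lemma exists_invariant_approximation:
  assumes gen: "finite_generating_set H T" and nonamenable: "\<not> amenable H" and p: "0 < p"
    and vanish: "\<And>v. (\<And>h. h \<in> carrier H \<Longrightarrow> lp_variation p H v h < \<infinity>) \<Longrightarrow>
      \<exists>c. lp_energy p (carrier H) (\<lambda>k. v k - c) < \<infinity>"
    and F [measurable]: "F \<in> borel_measurable M"
    and disp: "\<And>h. h \<in> carrier H \<Longrightarrow> (\<integral>\<^sup>+x. ennreal (\<bar>F (\<psi> h x) - F x\<bar> powr p) \<partial>M) < \<infinity>"
  obtains c where "c \<in> borel_measurable M"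
    "\<And>h x. \<lbrakk>h \<in> carrier H; x \<in> space M\<rbrakk> \<Longrightarrow> c (\<psi> h x) = c x"
    "(\<integral>\<^sup>+x. ennreal (\<bar>F x - c x\<bar> powr p) \<partial>M) < \<infinity>"
proof -
  let ?H = "carrier H"
  have T: "finite T" "T \<subseteq> ?H"
    using gen by (auto simp: finite_generating_set_def)
  have inf: "infinite ?H"
    by (rule HA.nonamenable_infinite[OF gen nonamenable])
  \<comment> \<open>As H is infinite, e is injective, and finite energy determines the constant
    along it.\<close>
  define e where "e = from_nat_into ?H"
  have e: "inj e" "range e \<subseteq> ?H" "e n \<in> ?H" for n
    using bij_betw_from_nat_into[OF HA.countable_carrier inf] by (auto simp: e_def bij_betw_def)
  define good where "good x c \<longleftrightarrow> lp_energy p ?H (\<lambda>k. F (\<psi> k x) - c) < \<infinity>" for x c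
  define L where "L x = lim (\<lambda>n. F (\<psi> (e n) x))" for x
  \<comment> \<open>On orbits without a good constant \<open>L\<close> may depend on the starting
    point; the default 0 keeps c invariant everywhere, not only almost everywhere.\<close>
  define c where "c x = (if good x (L x) then L x else 0)" for x
  have good_L: "c' = L x" if "good x c'" for x c'
  proof -
    have "(\<lambda>n. F (\<psi> (e n) x)) \<longlonglongrightarrow> c'"
      using that unfolding good_def by (rule lp_energy_finite_tendsto[OF p]) (use e in auto)
    then show ?thesis
      by (simp add: L_def limI)
  qed
  have F_act [measurable]: "(\<lambda>x. F (\<psi> h x)) \<in> borel_measurable M" if "h \<in> ?H" for h
    by (rule measurable_compose[OF HA.measurable_act[OF that] F])
  have [measurable]: "L \<in> borel_measurable M"
    unfolding L_def using e(3) by (intro borel_measurable_lim_metric F_act)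
  have [measurable]: "(\<lambda>x. lp_energy p ?H (\<lambda>k. F (\<psi> k x) - L x)) \<in> borel_measurable M"
    by (intro borel_measurable_lp_energy HA.countable_carrier) measurable
  have c_measurable [measurable]: "c \<in> borel_measurable M"
    unfolding c_def good_def by measurable
  have good_act: "good (\<psi> h x) c' \<longleftrightarrow> good x c'" if "h \<in> ?H" "x \<in> space M" for h x c'
  proof -
    have "lp_energy p ?H (\<lambda>k. F (\<psi> k (\<psi> h x)) - c') = lp_energy p ?H (\<lambda>k. F (\<psi> (k \<otimes>\<^bsub>H\<^esub> h) x) - c')"
      using that by (intro lp_energy_cong) (simp add: HA.act_mult)
    also have "\<dots> = lp_energy p ?H (\<lambda>k. F (\<psi> k x) - c')"
      by (rule HA.lp_energy_r_mult[OF that(1), where f = "\<lambda>k. F (\<psi> k x) - c'"])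
    finally show ?thesis by (simp add: good_def)
  qed
  have c_act: "c (\<psi> h x) = c x" if "h \<in> ?H" "x \<in> space M" for h x
  proof (cases "\<exists>c'. good x c'")
    case True
    then obtain c' where c': "good x c'" by blast
    then have "good (\<psi> h x) c'"
      using good_act that by blast
    with c' show ?thesis
      using good_L[OF c'] good_L[of "\<psi> h x" c'] by (simp add: c_def)
  next
    case False
    then show ?thesis
      using good_act[OF that] by (auto simp: c_def)
  qed
  define A where "A h x = lp_energy p ?H (\<lambda>k. F (\<psi> h (\<psi> k x)) - F (\<psi> k x))" for h x
  have A_measurable [measurable]: "A h \<in> borel_measurable M" if h: "h \<in> ?H" for h
    unfolding A_def
  proof (intro borel_measurable_lp_energy HA.countable_carrier)
    fix k assume k: "k \<in> ?H"
    have [measurable]: "(\<lambda>x. F (\<psi> h (\<psi> k x))) \<in> borel_measurable M"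
      by (rule measurable_compose[OF HA.measurable_act[OF k] F_act[OF h]])
    show "(\<lambda>x. F (\<psi> h (\<psi> k x)) - F (\<psi> k x)) \<in> borel_measurable M"
      using k by measurable
  qed
  have A_integral: "(\<integral>\<^sup>+x\<in>XH. A h x \<partial>M) < \<infinity>" if h: "h \<in> ?H" for h
    using disp[OF h] HA.nn_integral_unfold[OF measurable_displacement[OF h F], of p]
    by (simp add: A_def lp_energy_def)
  \<comment> \<open>Inverting k makes right translation of the function by h correspond to acting on
    the orbit by the inverse of h, so that the variation becomes a displacement of F.\<close>
  have variation: "lp_variation p H (\<lambda>k. F (\<psi> (inv\<^bsub>H\<^esub> k) x)) h = A (inv\<^bsub>H\<^esub> h) x"
    if "h \<in> ?H" "x \<in> space M" for h x
  proof -
    have "lp_variation p H (\<lambda>k. F (\<psi> (inv\<^bsub>H\<^esub> k) x)) h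
        = lp_energy p ?H (\<lambda>k. F (\<psi> (inv\<^bsub>H\<^esub> h) (\<psi> (inv\<^bsub>H\<^esub> k) x)) - F (\<psi> (inv\<^bsub>H\<^esub> k) x))"
      unfolding lp_variation_def using that
      by (intro lp_energy_cong) (simp add: HA.inv_mult_group HA.act_mult)
    also have "\<dots> = A (inv\<^bsub>H\<^esub> h) x"
      unfolding A_def
      by (rule lp_energy_bij_betw[OF HA.bij_betw_m_inv,
          where f = "\<lambda>k. F (\<psi> (inv\<^bsub>H\<^esub> h) (\<psi> k x)) - F (\<psi> k x)"])
    finally show ?thesis .
  qed
  \<comment> \<open>C does not depend on x, so the orbitwise bound can be integrated over
    \<open>XH\<close>.\<close>
  obtain C where C: "\<And>v. lp_energy p ?H v < \<infinity> \<Longrightarrow>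
      lp_energy p ?H v \<le> ennreal C * (\<Sum>t\<in>T. lp_variation p H v t)"
    using HA.nonamenable_lp_energy_gap[OF gen nonamenable p] by blast
  have "AE x in M. \<forall>h\<in>?H. A h x * indicator XH x \<noteq> \<infinity>"
  proof (intro AE_ball_countable[THEN iffD2] HA.countable_carrier ballI)
    fix h assume h: "h \<in> ?H"
    show "AE x in M. A h x * indicator XH x \<noteq> \<infinity>"
      using A_integral[OF h] A_measurable[OF h] by (intro nn_integral_PInf_AE) auto
  qed
  then have bound: "AE x in M. lp_energy p ?H (\<lambda>k. F (\<psi> k x) - c x) * indicator XH x
      \<le> ennreal C * (\<Sum>t\<in>T. A (inv\<^bsub>H\<^esub> t) x * indicator XH x)"
    using AE_space
  proof eventually_elim
    case (elim x)
    show ?case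
    proof (cases "x \<in> XH")
      case True
      let ?v = "\<lambda>k. F (\<psi> (inv\<^bsub>H\<^esub> k) x)"
      have "lp_variation p H ?v h < \<infinity>" if "h \<in> ?H" for h
        using elim True that by (auto simp: variation less_top)
      then obtain c' where "lp_energy p ?H (\<lambda>k. ?v k - c') < \<infinity>"
        using vanish[of ?v] by blast
      moreover have inv_energy: "lp_energy p ?H (\<lambda>k. ?v k - d) = lp_energy p ?H (\<lambda>k. F (\<psi> k x) - d)" for d
        by (rule lp_energy_bij_betw[OF HA.bij_betw_m_inv, where f = "\<lambda>k. F (\<psi> k x) - d"])
      ultimately have "good x c'"
        by (simp add: good_def)
      then have "good x (c x)"
        using good_L[of x c'] by (simp add: c_def)
      then have "lp_energy p ?H (\<lambda>k. ?v k - c x) < \<infinity>"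
        by (simp add: good_def inv_energy)
      then have "lp_energy p ?H (\<lambda>k. ?v k - c x) \<le> ennreal C * (\<Sum>t\<in>T. lp_variation p H (\<lambda>k. ?v k - c x) t)"
        by (rule C)
      also have "(\<Sum>t\<in>T. lp_variation p H (\<lambda>k. ?v k - c x) t) = (\<Sum>t\<in>T. A (inv\<^bsub>H\<^esub> t) x)"
      proof (rule sum.cong)
        fix t assume "t \<in> T"
        then show "lp_variation p H (\<lambda>k. ?v k - c x) t = A (inv\<^bsub>H\<^esub> t) x"
          using T elim by (subst variation[symmetric]) (auto simp: lp_variation_def)
      qed simp
      finally show ?thesis
        using True by (simp add: inv_energy)
    qed simp
  qed
  have "(\<integral>\<^sup>+x. ennreal (\<bar>F x - c x\<bar> powr p) \<partial>M)
      = (\<integral>\<^sup>+x\<in>XH. (\<integral>\<^sup>+k. ennreal (\<bar>F (\<psi> k x) - c (\<psi> k x)\<bar> powr p) \<partial>count_space ?H) \<partial>M)"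
    by (rule HA.nn_integral_unfold) measurable
  also have "\<dots> = (\<integral>\<^sup>+x\<in>XH. lp_energy p ?H (\<lambda>k. F (\<psi> k x) - c x) \<partial>M)"
    unfolding lp_energy_def
    by (intro nn_integral_cong arg_cong2[where f = "(*)"]) (auto simp: c_act intro!: nn_integral_cong)
  also have "\<dots> \<le> (\<integral>\<^sup>+x. ennreal C * (\<Sum>t\<in>T. A (inv\<^bsub>H\<^esub> t) x * indicator XH x) \<partial>M)"
    by (rule nn_integral_mono_AE[OF bound])
  also have "\<dots> = ennreal C * (\<Sum>t\<in>T. (\<integral>\<^sup>+x\<in>XH. A (inv\<^bsub>H\<^esub> t) x \<partial>M))"
  proof -
    have [measurable]: "A (inv\<^bsub>H\<^esub> t) \<in> borel_measurable M" if "t \<in> T" for t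
      using that T by (intro A_measurable) auto
    show ?thesis
      by (subst nn_integral_cmult, measurable) (subst nn_integral_sum, measurable)
  qed
  also have "\<dots> < \<infinity>"
  proof -
    have "(\<integral>\<^sup>+x\<in>XH. A (inv\<^bsub>H\<^esub> t) x \<partial>M) < \<infinity>" if "t \<in> T" for t
      using that T by (intro A_integral) auto
    then show ?thesis
      using T(1) by (simp add: ennreal_mult_less_top)
  qed
  finally have "(\<integral>\<^sup>+x. ennreal (\<bar>F x - c x\<bar> powr p) \<partial>M) < \<infinity>" .
  with c_measurable c_act show thesis
    by (rule that)
qed

text \<open>The function \<open>N x\<close> is the \<open>p\<close>-th power of the distance in \<open>f + l\<^sup>p(G)\<close> between \<open>f\<close> and
  \<open>g \<mapsto> c (\<phi> g x)\<close>. Its sublevel sets descend to \<open>X / H\<close>, on which \<open>G\<close> preserves the finite measure, so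
  one with more than half of the mass meets all its translates.\<close>

lemma bounded_lp_variation_if_approximation:
  assumes p: "0 < p" and nonzero: "emeasure M (space M) \<noteq> 0"
    and fin: "\<And>g. g \<in> carrier G \<Longrightarrow> lp_variation p G f g < \<infinity>"
    and c [measurable]: "c \<in> borel_measurable M"
    and c_inv: "\<And>h x. \<lbrakk>h \<in> carrier H; x \<in> space M\<rbrakk> \<Longrightarrow> c (\<psi> h x) = c x"
    and approx: "(\<integral>\<^sup>+x. ennreal (\<bar>induced f x - c x\<bar> powr p) \<partial>M) < \<infinity>"
  obtains R :: real where "\<And>g. g \<in> carrier G \<Longrightarrow> lp_variation p G f g \<le> ennreal R"
proof -
  let ?G = "carrier G"
  define N where "N x = lp_energy p ?G (\<lambda>g. c (\<phi> g x) - f g)" for x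
  have c_act [measurable]: "(\<lambda>x. c (\<phi> g x)) \<in> borel_measurable M" if "g \<in> ?G" for g
    by (rule measurable_compose[OF GA.measurable_act[OF that] c])
  have N_measurable [measurable]: "N \<in> borel_measurable M"
    unfolding N_def by (intro borel_measurable_lp_energy GA.countable_carrier) measurable
  have N_inv: "N (\<psi> h x) = N x" if "h \<in> carrier H" "x \<in> space M" for h x
    unfolding N_def using that by (intro lp_energy_cong) (simp add: commute c_inv GA.act_closed)
  have N_translate: "N (\<phi> k x) = lp_energy p ?G (\<lambda>g. c (\<phi> g x) - f (g \<otimes>\<^bsub>G\<^esub> inv\<^bsub>G\<^esub> k))"
    if "k \<in> ?G" "x \<in> space M" for k x
  proof -
    have "N (\<phi> k x) = lp_energy p ?G (\<lambda>g. c (\<phi> (g \<otimes>\<^bsub>G\<^esub> k) x) - f ((g \<otimes>\<^bsub>G\<^esub> k) \<otimes>\<^bsub>G\<^esub> inv\<^bsub>G\<^esub> k))"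
      unfolding N_def using that by (intro lp_energy_cong) (simp add: GA.act_mult GA.m_assoc)
    also have "\<dots> = lp_energy p ?G (\<lambda>g. c (\<phi> g x) - f (g \<otimes>\<^bsub>G\<^esub> inv\<^bsub>G\<^esub> k))"
      by (rule GA.lp_energy_r_mult[OF that(1), where f = "\<lambda>g. c (\<phi> g x) - f (g \<otimes>\<^bsub>G\<^esub> inv\<^bsub>G\<^esub> k)"])
    finally show ?thesis .
  qed
  \<comment> \<open>On \<open>XG\<close>, N is the inner sum of the unfolded integral in
    \<open>approx\<close>. From there finiteness spreads along G-orbits, because translating f
    changes it by finite energy.\<close>
  have N_finite: "AE x in M. N x < \<infinity>"
  proof (rule GA.AE_from_domain)
    have "(\<integral>\<^sup>+x. ennreal (\<bar>induced f x - c x\<bar> powr p) \<partial>M)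
        = (\<integral>\<^sup>+y\<in>XG. (\<integral>\<^sup>+g. ennreal (\<bar>induced f (\<phi> g y) - c (\<phi> g y)\<bar> powr p) \<partial>count_space ?G) \<partial>M)"
      by (rule GA.nn_integral_unfold) measurable
    also have "\<dots> = (\<integral>\<^sup>+y\<in>XG. N y \<partial>M)"
    proof (rule nn_integral_cong)
      fix y
      have "lp_energy p ?G (\<lambda>g. induced f (\<phi> g y) - c (\<phi> g y)) = N y" if "y \<in> XG"
        unfolding N_def using that by (intro lp_energy_cong) (simp add: induced_act_domain abs_minus_commute)
      then show "(\<integral>\<^sup>+g. ennreal (\<bar>induced f (\<phi> g y) - c (\<phi> g y)\<bar> powr p) \<partial>count_space ?G) * indicator XG y
          = N y * indicator XG y"
        by (auto simp: lp_energy_def indicator_def)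
    qed
    finally have "AE x in M. N x * indicator XG x \<noteq> \<infinity>"
      using approx by (intro nn_integral_PInf_AE) auto
    then show "AE x in M. x \<in> XG \<longrightarrow> N x < \<infinity>"
      by eventually_elim (auto simp: less_top)
  next
    fix k x assume k: "k \<in> ?G" and x: "x \<in> space M" and Nx: "N x < \<infinity>"
    show "N (\<phi> k x) < \<infinity>"
      unfolding N_translate[OF k x]
    proof (rule lp_energy_triangle_finite)
      show "lp_energy p ?G (\<lambda>g. c (\<phi> g x) - f g) < \<infinity>"
        using Nx by (simp add: N_def)
      show "lp_energy p ?G (\<lambda>g. f g - f (g \<otimes>\<^bsub>G\<^esub> inv\<^bsub>G\<^esub> k)) < \<infinity>"
        using fin[of "inv\<^bsub>G\<^esub> k"] k
        by (subst lp_energy_minus_commute) (simp add: lp_variation_def)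
    qed (use p in simp)
  qed
  \<comment> \<open>These sets decrease to a null set within a set of finite measure, so some B n
    has less than half the mass of \<open>XH\<close>. That n serves for all k.\<close>
  define B where "B n = {x \<in> XH. of_nat n < N x}" for n :: nat
  have [measurable]: "B n \<in> sets M" for n
  proof -
    have "B n = {x \<in> space M. x \<in> XH \<and> of_nat n < N x}"
      using HA.domain_subset by (auto simp: B_def)
    also have "\<dots> \<in> sets M" by measurable
    finally show ?thesis .
  qed
  have "AE x in M. x \<notin> (\<Inter>n. B n)"
    using N_finite
  proof eventually_elim
    case (elim x)
    then obtain n :: nat where "N x \<le> of_nat n"
      using ennreal_Ex_less_of_nat[of "N x"] by (auto simp: less_top intro: less_imp_le)
    then show ?case by (auto simp: B_def not_less)
  qed
  then have "(\<Inter>n. B n) \<in> null_sets M"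
    using AE_iff_null_sets[of "\<Inter>n. B n" M] by simp
  then have null: "emeasure M (\<Inter>n. B n) = 0" by auto
  have "(\<lambda>n. emeasure M (B n)) \<longlonglongrightarrow> emeasure M (\<Inter>n. B n)"
  proof (rule Lim_emeasure_decseq)
    show "decseq B"
      by (auto simp: B_def decseq_def intro: order_le_less_trans[rotated])
    show "emeasure M (B n) \<noteq> \<infinity>" for n
      using HA.emeasure_domain_finite emeasure_mono[of "B n" XH M] by (auto simp: B_def top_unique)
  qed auto
  then have "(\<lambda>n. emeasure M (B n) + emeasure M (B n)) \<longlonglongrightarrow> 0 + 0"
    unfolding null by (intro tendsto_add)
  moreover have "0 + 0 < emeasure M XH"
    using HA.emeasure_domain_pos[OF nonzero] by (simp add: zero_less_iff_neq_zero)
  ultimately have "\<forall>\<^sub>F n in sequentially. emeasure M (B n) + emeasure M (B n) < emeasure M XH"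
    by (rule order_tendstoD)
  then obtain n where small: "emeasure M (B n) + emeasure M (B n) < emeasure M XH"
    using eventually_happens'[OF sequentially_bot] by blast
  have "lp_variation p G f k \<le> ennreal (2 powr p * (real n + real n))" if k: "k \<in> ?G" for k
  proof -
    \<comment> \<open>Otherwise \<open>XH\<close> is covered by the set where N > n and its preimage
      under \<open>\<phi> k\<close>, each of which meets \<open>XH\<close> in the measure of B
      n.\<close>
    have "\<exists>x\<in>XH. N x \<le> of_nat n \<and> N (\<phi> k x) \<le> of_nat n"
    proof (rule ccontr)
      let ?u = "\<lambda>x. indicator {x \<in> space M. of_nat n < N x} x :: ennreal"
      have u_inv: "?u (\<psi> h x) = ?u x" if "h \<in> carrier H" "x \<in> space M" for h x
        using that by (simp add: indicator_def N_inv HA.act_closed)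
      have [measurable]: "(\<lambda>x. ?u (\<phi> k x)) \<in> borel_measurable M"
        by (rule measurable_compose[OF GA.measurable_act[OF k]]) measurable
      have u_int: "(\<integral>\<^sup>+x\<in>XH. ?u x \<partial>M) = emeasure M (B n)"
      proof -
        have "(\<integral>\<^sup>+x\<in>XH. ?u x \<partial>M) = (\<integral>\<^sup>+x. indicator (B n) x \<partial>M)"
          using HA.domain_subset by (intro nn_integral_cong) (auto simp: B_def indicator_def)
        then show ?thesis by simp
      qed
      assume "\<not> ?thesis"
      then have "indicator XH x \<le> ?u x * indicator XH x + ?u (\<phi> k x) * indicator XH x" if "x \<in> space M" for x
        using that k by (auto simp: indicator_def not_le GA.act_closed)
      then have "(\<integral>\<^sup>+x. indicator XH x \<partial>M) \<le> (\<integral>\<^sup>+x. ?u x * indicator XH x + ?u (\<phi> k x) * indicator XH x \<partial>M)"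
        by (rule nn_integral_mono)
      also have "\<dots> = (\<integral>\<^sup>+x\<in>XH. ?u x \<partial>M) + (\<integral>\<^sup>+x\<in>XH. ?u (\<phi> k x) \<partial>M)"
        by (rule nn_integral_add) measurable
      also have "(\<integral>\<^sup>+x\<in>XH. ?u (\<phi> k x) \<partial>M) = (\<integral>\<^sup>+x\<in>XH. ?u x \<partial>M)"
        by (rule nn_integral_invariant[OF _ u_inv k]) measurable
      finally show False
        using small by (simp add: u_int)
    qed
    then obtain x where x: "x \<in> XH" "N x \<le> of_nat n" "N (\<phi> k x) \<le> of_nat n"
      by blast
    then have "x \<in> space M"
      using HA.domain_subset by auto
    \<comment> \<open>The intermediate function g -> c (\<phi> (g k) x) is read in two ways:
      substituting g for g k gives the distance N x, and as the function attached to
      \<open>\<phi> k x\<close> it gives N (\<phi> k x).\<close>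
    have "lp_variation p G f k \<le> ennreal (2 powr p) *
        (lp_energy p ?G (\<lambda>g. f (g \<otimes>\<^bsub>G\<^esub> k) - c (\<phi> (g \<otimes>\<^bsub>G\<^esub> k) x)) + lp_energy p ?G (\<lambda>g. c (\<phi> (g \<otimes>\<^bsub>G\<^esub> k) x) - f g))"
      unfolding lp_variation_def using p by (intro lp_energy_triangle) simp
    also have "lp_energy p ?G (\<lambda>g. f (g \<otimes>\<^bsub>G\<^esub> k) - c (\<phi> (g \<otimes>\<^bsub>G\<^esub> k) x)) = N x"
      unfolding N_def lp_energy_minus_commute[of p ?G "\<lambda>g. c (\<phi> g x)"]
      by (rule GA.lp_energy_r_mult[OF k, where f = "\<lambda>g. f g - c (\<phi> g x)"])
    also have "lp_energy p ?G (\<lambda>g. c (\<phi> (g \<otimes>\<^bsub>G\<^esub> k) x) - f g) = N (\<phi> k x)"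
      unfolding N_def using k \<open>x \<in> space M\<close> by (intro lp_energy_cong) (simp add: GA.act_mult)
    also have "ennreal (2 powr p) * (N x + N (\<phi> k x)) \<le> ennreal (2 powr p) * (of_nat n + of_nat n)"
      using x by (intro mult_left_mono add_mono) auto
    also have "\<dots> = ennreal (2 powr p * (real n + real n))"
      unfolding ennreal_of_nat_eq_real_of_nat by (subst ennreal_mult, simp, simp, subst ennreal_plus, simp_all)
    finally show ?thesis .
  qed
  then show thesis by (rule that)
qed

end

section \<open>The transfer\<close>

lemma Lq_measure_equivalent_sym:
  "Lq_measure_equivalent TYPE('x) q G H \<Longrightarrow> Lq_measure_equivalent TYPE('x) q H G"
  unfolding Lq_measure_equivalent_def ME_coupling_def
proof (elim exE conjE)
  fix S T and M :: "'x measure" and \<phi> \<psi> XG XH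
  assume *: "finite_generating_set G S" "finite_generating_set H T" "sigma_finite_measure M"
    "emeasure M (space M) \<noteq> 0" "free_mp_action G M \<phi>" "free_mp_action H M \<psi>"
    "\<forall>g\<in>carrier G. \<forall>h\<in>carrier H. \<forall>x\<in>space M. \<phi> g (\<psi> h x) = \<psi> h (\<phi> g x)"
    "finite_fundamental_domain G M \<phi> XG" "finite_fundamental_domain H M \<psi> XH"
    "\<forall>g\<in>carrier G. (\<integral>\<^sup>+x\<in>XH. ennreal (real (word_length H T (ME_cocycle H \<phi> \<psi> XH g x)) powr q) \<partial>M) < \<infinity>"
    "\<forall>h\<in>carrier H. (\<integral>\<^sup>+x\<in>XG. ennreal (real (word_length G S (ME_cocycle G \<psi> \<phi> XG h x)) powr q) \<partial>M) < \<infinity>"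
  show "\<exists>S T (M :: 'x measure) \<phi> \<psi> XG XH. finite_generating_set H S \<and> finite_generating_set G T \<and>
      (sigma_finite_measure M \<and> emeasure M (space M) \<noteq> 0 \<and> free_mp_action H M \<phi> \<and> free_mp_action G M \<psi> \<and>
       (\<forall>g\<in>carrier H. \<forall>h\<in>carrier G. \<forall>x\<in>space M. \<phi> g (\<psi> h x) = \<psi> h (\<phi> g x)) \<and>
       finite_fundamental_domain H M \<phi> XG \<and> finite_fundamental_domain G M \<psi> XH) \<and>
      (\<forall>g\<in>carrier H. (\<integral>\<^sup>+x\<in>XH. ennreal (real (word_length G T (ME_cocycle G \<phi> \<psi> XH g x)) powr q) \<partial>M) < \<infinity>) \<and>
      (\<forall>h\<in>carrier G. (\<integral>\<^sup>+x\<in>XG. ennreal (real (word_length H S (ME_cocycle H \<psi> \<phi> XG h x)) powr q) \<partial>M) < \<infinity>)"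
    by (rule exI[of _ T], rule exI[of _ S], rule exI[of _ M], rule exI[of _ \<psi>], rule exI[of _ \<phi>],
        rule exI[of _ XH], rule exI[of _ XG]) (use * in auto)
qed

lemma bounded_lp_variation_if_lpH1_is_zero:
  fixes G :: "('a, 'c) monoid_scheme" and H :: "('b, 'd) monoid_scheme"
  assumes groups: "group G" "group H"
    and gen: "finite_generating_set H T" and nonamenable: "\<not> amenable H"
    and p: "1 \<le> p" "p \<le> q" and equiv: "Lq_measure_equivalent TYPE('x) q G H"
    and zero: "lpH1_is_zero p H T"
    and fin: "\<And>g. g \<in> carrier G \<Longrightarrow> lp_variation p G f g < \<infinity>"
  obtains R :: real where "\<And>g. g \<in> carrier G \<Longrightarrow> lp_variation p G f g \<le> ennreal R"
proof -
  \<comment> \<open>\<open>S'\<close> comes with the coupling and measures the cocycle, while T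
    computes the cohomology of H.\<close>
  obtain S' T' \<phi> \<psi> XG XH and M :: "'x measure" where
    S': "finite_generating_set G S'" and cpl: "ME_coupling G H M \<phi> \<psi> XG XH"
    and int: "\<And>h. h \<in> carrier H \<Longrightarrow>
      (\<integral>\<^sup>+x\<in>XG. ennreal (real (word_length G S' (ME_cocycle G \<psi> \<phi> XG h x)) powr q) \<partial>M) < \<infinity>"
    using equiv unfolding Lq_measure_equivalent_def by blast
  interpret G: group G by fact
  interpret H: group H by fact
  interpret coupling G H M \<phi> \<psi> XG XH
    using cpl G.countable_carrier_if_finitely_generated[OF S'] H.countable_carrier_if_finitely_generated[OF gen]
    by unfold_locales (auto simp: ME_coupling_def)
  have p0: "0 < p" using p by simp
  have vanish: "\<exists>c. lp_energy p (carrier H) (\<lambda>k. v k - c) < \<infinity>"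
    if "\<And>h. h \<in> carrier H \<Longrightarrow> lp_variation p H v h < \<infinity>" for v
    using zero that unfolding H.lpH1_is_zero_iff[OF gen p(1)] by blast
  have disp: "(\<integral>\<^sup>+x. ennreal (\<bar>induced f (\<psi> h x) - induced f x\<bar> powr p) \<partial>M) < \<infinity>" if "h \<in> carrier H" for h
    by (rule induced_displacement_finite[OF S' p fin that int[OF that]])
  have nonzero: "emeasure M (space M) \<noteq> 0"
    using cpl by (simp add: ME_coupling_def)
  show thesis
  proof (rule exists_invariant_approximation[OF gen nonamenable p0 vanish measurable_induced[of f] disp])
    fix c assume c: "c \<in> borel_measurable M" "\<And>h x. \<lbrakk>h \<in> carrier H; x \<in> space M\<rbrakk> \<Longrightarrow> c (\<psi> h x) = c x"
      "(\<integral>\<^sup>+x. ennreal (\<bar>induced f x - c x\<bar> powr p) \<partial>M) < \<infinity>"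
    show thesis
    proof (rule bounded_lp_variation_if_approximation[OF p0 nonzero fin c])
      fix R :: real assume "\<And>g. g \<in> carrier G \<Longrightarrow> lp_variation p G f g \<le> ennreal R"
      then show thesis by (rule that)
    qed
  qed
qed

lemma lpH1_is_zero_transfer:
  fixes G :: "('a, 'c) monoid_scheme" and H :: "('b, 'd) monoid_scheme"
  assumes "group G" "group H" "finite_generating_set G S" "finite_generating_set H T"
    and "\<not> amenable G" "\<not> amenable H" "1 \<le> p" "p \<le> q"
    and "Lq_measure_equivalent TYPE('x) q G H" "lpH1_is_zero p H T"
  shows "lpH1_is_zero p G S"
proof -
  interpret G: group G by fact
  have inf: "infinite (carrier G)"
    by (rule G.nonamenable_infinite) fact+
  show ?thesis
    unfolding G.lpH1_is_zero_iff[OF assms(3,7)]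
  proof (intro allI impI)
    fix f assume "\<forall>g\<in>carrier G. lp_variation p G f g < \<infinity>"
    then obtain R :: real where "\<And>g. g \<in> carrier G \<Longrightarrow> lp_variation p G f g \<le> ennreal R"
      using bounded_lp_variation_if_lpH1_is_zero[OF assms(1,2,4,6-10)] by blast
    then show "\<exists>c. lp_energy p (carrier G) (\<lambda>x. f x - c) < \<infinity>"
      using \<open>1 \<le> p\<close> by (intro G.bounded_lp_variation_imp_const[OF inf]) auto
  qed
qed

text \<open>Evaluating the cocycle identity for \<open>x \<otimes> g\<close> at the identity
  exhibits b as the coboundary of x -> b x \<one>, a function that need not lie in l^p.\<close>

lemma (in group) one_cocycle_potential:
  assumes "one_cocycle G B (right_regular G) b" "g \<in> carrier G" "x \<in> carrier G"
  shows "b g x = b (x \<otimes> g) \<one> - b x \<one>"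
proof -
  have "b (x \<otimes> g) = b x + right_regular G x (b g)"
    using assms by (auto simp: one_cocycle_def)
  then show ?thesis
    using assms by (simp add: right_regular_def on_set_def)
qed

text \<open>The linear part is isometric, and the norm of b g is the variation of the potential, so
  the hypothesis bounds the translation parts.\<close>

lemma (in group) bounded_orbits_right_regular:
  assumes b: "one_cocycle G (lp_space 1 (carrier G)) (right_regular G) b"
    and R: "\<And>g. g \<in> carrier G \<Longrightarrow> lp_variation 1 G (\<lambda>x. b x \<one>) g \<le> ennreal R"
  shows "bounded_orbits G (lp_space 1 (carrier G)) (lp_norm 1 (carrier G)) (affine_action (right_regular G) b)"
  unfolding bounded_orbits_def
proof
  let ?V = "carrier G"
  fix v assume "v \<in> lp_space 1 ?V"
  then have v: "lp_energy 1 ?V v < \<infinity>"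
    by (simp add: lp_space_iff)
  \<comment> \<open>The factor 2 is \<open>2 powr p\<close> of \<open>lp_energy_add\<close> at p =
    1.\<close>
  define K where "K = enn2real (2 * (lp_energy 1 ?V v + ennreal R))"
  have K: "2 * (lp_energy 1 ?V v + ennreal R) = ennreal K"
    using v by (simp add: K_def ennreal_mult_less_top)
  have "lp_norm 1 ?V (affine_action (right_regular G) b g v) \<le> K" if g: "g \<in> ?V" for g
  proof -
    let ?u = "affine_action (right_regular G) b g v"
    have "lp_energy 1 ?V (right_regular G g v) = lp_energy 1 ?V v"
      unfolding lp_energy_r_mult[OF g, of 1 v, symmetric]
      by (rule lp_energy_cong) (simp add: right_regular_def on_set_def)
    moreover have "lp_energy 1 ?V (b g) = lp_variation 1 G (\<lambda>x. b x \<one>) g"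
      unfolding lp_variation_def
      by (rule lp_energy_cong) (simp add: one_cocycle_potential[OF b g])
    ultimately have le: "lp_energy 1 ?V ?u \<le> ennreal K"
      using lp_energy_add[of 1 ?V "right_regular G g v" "b g"] R[OF g] unfolding K[symmetric]
      by (simp add: affine_action_def plus_fun_def) (meson add_left_mono mult_left_mono order_trans zero_le)
    then have fin: "lp_energy 1 ?V ?u < \<infinity>"
      by (rule le_less_trans) simp
    have "ennreal (\<Sum>\<^sub>\<infinity>x\<in>?V. \<bar>?u x\<bar> powr 1) \<le> ennreal K"
      using le unfolding lp_energy_eq_infsum[OF fin] .
    then show ?thesis
      by (simp add: lp_norm_def K_def infsum_nonneg)
  qed
  then show "\<exists>C. \<forall>u\<in>orbit G (affine_action (right_regular G) b) v. lp_norm 1 ?V u \<le> C"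
    by (auto simp: orbit_def)
qed

theorem theorem1p1:
  fixes G :: "('a, 'c) monoid_scheme" and H :: "('b, 'd) monoid_scheme"
    and S :: "'a set" and T :: "'b set" and q :: real
  assumes "group G" and "group H"
    and "finite_generating_set G S" and "finite_generating_set H T"
    and "\<not> amenable G" and "\<not> amenable H"
    and "1 \<le> q" and "Lq_measure_equivalent TYPE('x) q G H"
  shows "(\<forall>p. 1 < p \<and> p \<le> q \<longrightarrow> (\<not> lpH1_is_zero p G S \<longleftrightarrow> \<not> lpH1_is_zero p H T)) \<and>
    (lpH1_is_zero 1 H T \<longrightarrow>
      (\<forall>b. one_cocycle G (lp_space 1 (carrier G)) (right_regular G) b \<longrightarrow>
        bounded_orbits G (lp_space 1 (carrier G)) (lp_norm 1 (carrier G))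
          (affine_action (right_regular G) b)))"
proof (intro conjI allI impI)
  fix p :: real assume p: "1 < p \<and> p \<le> q"
  have "lpH1_is_zero p G S" if "lpH1_is_zero p H T"
    using lpH1_is_zero_transfer[OF assms(1-6) _ _ assms(8) that] p by simp
  moreover have "lpH1_is_zero p H T" if "lpH1_is_zero p G S"
    \<comment> \<open>The coupling is symmetric in the two groups, so the converse is the same
      transfer with exchanged roles.\<close>
    using lpH1_is_zero_transfer[OF assms(2,1,4,3,6,5) _ _ Lq_measure_equivalent_sym[OF assms(8)] that] p
    by simp
  ultimately show "\<not> lpH1_is_zero p G S \<longleftrightarrow> \<not> lpH1_is_zero p H T"
    by blast
next
  fix b assume zero: "lpH1_is_zero 1 H T"
    and b: "one_cocycle G (lp_space 1 (carrier G)) (right_regular G) b"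
  interpret G: group G by fact
  let ?f = "\<lambda>x. b x \<one>\<^bsub>G\<^esub>"
  \<comment> \<open>The potential of b has finite variation because each b g lies in l^1.\<close>
  have fin: "lp_variation 1 G ?f g < \<infinity>" if g: "g \<in> carrier G" for g
  proof -
    have "lp_variation 1 G ?f g = lp_energy 1 (carrier G) (b g)"
      unfolding lp_variation_def
      by (rule lp_energy_cong) (simp add: G.one_cocycle_potential[OF b g])
    moreover have "b g \<in> lp_space 1 (carrier G)"
      using b g by (auto simp: one_cocycle_def)
    ultimately show ?thesis
      by (simp add: lp_space_iff)
  qed
  show "bounded_orbits G (lp_space 1 (carrier G)) (lp_norm 1 (carrier G))
      (affine_action (right_regular G) b)"
  proof (rule bounded_lp_variation_if_lpH1_is_zero[OF assms(1,2,4,6) order_refl assms(7,8) zero fin])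
    fix R :: real
    assume "\<And>g. g \<in> carrier G \<Longrightarrow> lp_variation 1 G ?f g \<le> ennreal R"
    then show ?thesis
      by (rule G.bounded_orbits_right_regular[OF b])
  qed
qed

end
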